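(* Let $K\subset\mathbb{R}^n$ be a nonempty closed semi-algebraic set and let $f_1,\dots,f_m:\mathbb{R}^n\to\mathbb{R}$ be polynomial functions. Then both the stationary point set $\mathrm{Stat}(\mathrm{PVP})$ and the proper stationary point set $\mathrm{Pr}(\mathrm{PVP})$ of the polynomial vector optimization problem of minimizing $f=(f_1,\dots,f_m)$ over $K$ are semi-algebraic subsets of $\mathbb{R}^n$. Consequently, each of them has finitely many connected components and every connected component is path connected.
   Context: A set in $\mathbb{R}^n$ is semi-algebraic if it is a finite union of sets of the form $\{x\in\mathbb{R}^n: h_1(x)=\dots=h_\ell(x)=0,\ g_{\ell+1}(x)<0,\dots,g_p(x)<0\}$ with all $h_i,g_j$ in $\mathbb{R}[x_1,\dots,x_n]$. Let $\Delta=\{(\xi_1,\dots,\xi_m)\in\mathbb{R}^m_+:\sum_{l=1}^m\xi_l=1\}$ and $\mathrm{ri}\,\Delta=\{\xi\in\Delta:\xi_l>0,\ l=1,\dots,m\}$. For $\xi\in\Delta$ let $$\mathrm{Sol}(\mathrm{VI})_\xi=\Big\{x\in K:\ \Big\langle\sum_{l=1}^m\xi_l\nabla f_l(x),\,y-x\Big\rangle\ge 0\ \text{ for all } y\in K\Big\},$$ where $\nabla f_l(x)$ is the gradient of $f_l$ at $x$ and $\langle\cdot,\cdot\rangle$ is the standard scalar product. A point $x\in K$ is a stationary point if $x\in\mathrm{Sol}(\mathrm{VI})_\xi$ for some $\xi\in\Delta$, and a proper stationary point if $x\in\mathrm{Sol}(\mathrm{VI})_\xi$ for some $\xi\in\mathrm{ri}\,\Delta$.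 Thus $$\mathrm{Stat}(\mathrm{PVP})=\bigcup_{\xi\in\Delta}\mathrm{Sol}(\mathrm{VI})_\xi,\qquad \mathrm{Pr}(\mathrm{PVP})=\bigcup_{\xi\in\mathrm{ri}\,\Delta}\mathrm{Sol}(\mathrm{VI})_\xi.$$ Connected components and path connectedness are with respect to the topology induced from $\mathbb{R}^n$. *)

theory Defs
  imports "HOL-Analysis.Analysis"
begin

text \<open>The polynomial functions on \<^typ>\<open>real^'n\<close> are the functions satisfying
  \<^const>\<open>real_polynomial_function\<close>: this is the algebra generated by the constants and the
  linear functionals, i.e. by the constants and the coordinate functions. Either of the
  families of equations and inequalities below may be empty.\<close>

definition basic_semialgebraic :: "(real^'n) set \<Rightarrow> bool" where
  "basic_semialgebraic S \<longleftrightarrow>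
     (\<exists>H G. finite H \<and> finite G \<and>
        (\<forall>h\<in>H. real_polynomial_function h) \<and> (\<forall>g\<in>G. real_polynomial_function g) \<and>
        S = {x. (\<forall>h\<in>H. h x = 0) \<and> (\<forall>g\<in>G. g x < 0)})"

definition semialgebraic :: "(real^'n) set \<Rightarrow> bool" where
  "semialgebraic S \<longleftrightarrow>
     (\<exists>\<F>. finite \<F> \<and> (\<forall>B\<in>\<F>. basic_semialgebraic B) \<and> S = \<Union>\<F>)"

text \<open>The gradient is only meaningful where \<open>f\<close> is differentiable; polynomial functions
  are differentiable everywhere, see \<open>GDERIV_gradient_polynomial\<close> below.\<close>

definition gradient :: "(real^'n \<Rightarrow> real) \<Rightarrow> real^'n \<Rightarrow> real^'n" where
  "gradient f x = (THE D. GDERIV f x :> D)"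

lemma gradient_eqI:
  assumes "GDERIV f x :> D"
  shows "gradient f x = D"
  unfolding gradient_def
proof (rule the_equality)
  fix D' assume "GDERIV f x :> D'"
  with assms have "(\<lambda>h. inner h D') = (\<lambda>h. inner h D)"
    unfolding gderiv_def by (rule has_derivative_unique[rotated])
  then have "\<forall>h. inner h D' = inner h D" by (rule fun_cong[THEN allI])
  then show "D' = D" by (simp add: vector_eq_ldot)
qed (rule assms)

lemma GDERIV_gradient_polynomial:
  assumes "real_polynomial_function f"
  shows "GDERIV f x :> gradient f x"
proof -
  have "\<exists>D. GDERIV f x :> D"
    using assms
  proof induction
    case (linear f)
    then interpret bounded_linear f .
    have "f h = inner h (adjoint f 1)" for h
      using adjoint_works[OF linear_axioms, of h 1] by simp
    then have "f = (\<lambda>h. inner h (adjoint f 1))" by blast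
    then show ?case
      using bounded_linear_imp_has_derivative[OF bounded_linear_axioms] unfolding gderiv_def by metis
  qed (blast intro: GDERIV_const GDERIV_add GDERIV_mult)+
  then show ?thesis using gradient_eqI by blast
qed

definition std_simplex :: "(real^'m) set" where
  "std_simplex = {\<xi>. (\<forall>l. \<xi> $ l \<ge> 0) \<and> (\<Sum>l\<in>UNIV. \<xi> $ l) = 1}"

definition ri_std_simplex :: "(real^'m) set" where
  "ri_std_simplex = {\<xi> \<in> std_simplex. \<forall>l. \<xi> $ l > 0}"

definition Sol_VI :: "(real^'n) set \<Rightarrow> ('m::finite \<Rightarrow> real^'n \<Rightarrow> real) \<Rightarrow> real^'m \<Rightarrow> (real^'n) set" where
  "Sol_VI K f \<xi> =
     {x \<in> K. \<forall>y\<in>K. inner (\<Sum>l\<in>UNIV. \<xi> $ l *\<^sub>R gradient (f l) x) (y - x) \<ge> 0}"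

definition Stat_PVP :: "(real^'n) set \<Rightarrow> ('m::finite \<Rightarrow> real^'n \<Rightarrow> real) \<Rightarrow> (real^'n) set" where
  "Stat_PVP K f = (\<Union>\<xi>\<in>std_simplex. Sol_VI K f \<xi>)"

definition Pr_PVP :: "(real^'n) set \<Rightarrow> ('m::finite \<Rightarrow> real^'n \<Rightarrow> real) \<Rightarrow> (real^'n) set" where
  "Pr_PVP K f = (\<Union>\<xi>\<in>ri_std_simplex. Sol_VI K f \<xi>)"

end

theory Submission
  imports Defs "HOL-Computational_Algebra.Fundamental_Theorem_Algebra"
begin

text \<open>Both sets are unions of solution sets over a semialgebraic set of parameters, so membership is
  a first-order condition over the reals: there is \<open>\<xi>\<close> in the simplex such that for all \<open>y \<in> K\<close> a
  polynomial expression in \<open>x\<close>, \<open>\<xi>\<close>, \<open>y\<close> is nonnegative (gradients of polynomials are polynomial).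
  Semialgebraicity is therefore quantifier elimination, and the statement on components is a
  general fact on semialgebraic sets.

  Both rest on one analysis of a finite family \<open>F\<close> of univariate polynomials whose coefficients
  depend polynomially on a parameter \<open>x\<close>. If \<open>F\<close> is closed under differentiation, then by Thom's
  lemma (\<open>thom_interval\<close>) a sign pattern of \<open>F\<close> is taken on a convex set, and the order of
  points with different patterns can be read off the patterns (\<open>thom_order_iff\<close>). So over each
  parameter the line is cut into finitely many ordered points and intervals, labelled by patterns.

  The set of patterns that occur over \<open>x\<close> depends only on the signs of finitely many polynomials
  in \<open>x\<close> (\<open>sign_patterns_determined\<close>). This is an induction on the degree. A polynomial \<open>P\<close>
  of top degree is monotone between neighbouring roots of the others, since its derivative is
  among them, and at those roots it has the sign of a polynomial of lower degree, obtained by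
  cancelling its leading term; so the patterns of the lower-degree family determine those of the
  family with \<open>P\<close> (\<open>patterns_subset_insert\<close>). Elimination of a quantifier follows at once
  (\<open>sa_projection\<close>).

  Over a set of parameters with the same patterns, each pattern also has a continuous section
  (\<open>continuous_section\<close>). With induction on the number of variables this yields two facts:
  a semialgebraic set is a finite union of path-connected semialgebraic sets
  (\<open>semialgebraic_path_connected_pieces\<close>), and a point in the closure of a semialgebraic set can
  be joined to it by a path that is outside the set at most at that point (\<open>curve_selection\<close>). The first makes path components
  finite in number and semialgebraic, the second then makes them closed; finitely many disjoint
  closed pieces are also open, so path components and components coincide
  (\<open>semialgebraic_components\<close>).\<close>

section \<open>Signs of univariate real polynomials\<close>

lemma sgn_mono_real: "(a::real) \<le> b \<Longrightarrow> sgn a \<le> sgn b"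
  by (auto simp: sgn_if)

lemma poly_mono_if_pderiv_nonneg:
  fixes p :: "real poly"
  assumes "a \<le> b" "\<And>u. a \<le> u \<Longrightarrow> u \<le> b \<Longrightarrow> 0 \<le> poly (pderiv p) u"
  shows "poly p a \<le> poly p b"
  by (rule DERIV_nonneg_imp_nondecreasing[OF assms(1)]) (use assms(2) poly_DERIV in blast)

lemma poly_sgn_constant_if_no_root:
  fixes p :: "real poly"
  assumes "\<And>u. min a b \<le> u \<Longrightarrow> u \<le> max a b \<Longrightarrow> poly p u \<noteq> 0"
  shows "sgn (poly p a) = sgn (poly p b)"
proof (rule ccontr)
  assume ne: "sgn (poly p a) \<noteq> sgn (poly p b)"
  have "poly p a \<noteq> 0" "poly p b \<noteq> 0" using assms[of a] assms[of b] by auto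
  with ne have "poly p a * poly p b < 0" "a \<noteq> b"
    by (auto simp: sgn_if mult_less_0_iff split: if_splits)
  then obtain u where "min a b < u" "u < max a b" "poly p u = 0"
    using poly_IVT[of a b p] poly_IVT[of b a p] by (cases "a < b") (auto simp: min_def max_def mult.commute)
  then show False using assms[of u] by simp
qed

lemma poly_zero_if_zero_on_interval:
  fixes p :: "real poly"
  assumes "a < b" "\<And>u. a \<le> u \<Longrightarrow> u \<le> b \<Longrightarrow> poly p u = 0"
  shows "p = 0"
proof (rule ccontr)
  assume "p \<noteq> 0"
  then have "finite {x. poly p x = 0}" by (rule poly_roots_finite)
  moreover have "{a..b} \<subseteq> {x. poly p x = 0}" using assms(2) by auto
  ultimately show False using finite_subset infinite_Icc[OF assms(1)] by blast
qed

text \<open>Derivatives of all orders are compared; beyond the degree they vanish, so only finitely many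
  conditions matter.\<close>

definition thom_eq :: "real poly \<Rightarrow> real \<Rightarrow> real \<Rightarrow> bool" where
  "thom_eq p s t \<longleftrightarrow> (\<forall>k. sgn (poly ((pderiv ^^ k) p) s) = sgn (poly ((pderiv ^^ k) p) t))"

lemma thom_eq_sgn: "thom_eq p s t \<Longrightarrow> sgn (poly p s) = sgn (poly p t)"
  unfolding thom_eq_def by (drule spec[of _ 0]) simp

lemma thom_eq_pderiv: "thom_eq p s t \<Longrightarrow> thom_eq (pderiv p) s t"
  unfolding thom_eq_def by (metis funpow_Suc_right o_apply)

text \<open>Thom's lemma. By induction the derivative has constant sign between the two points, so the
  polynomial is monotone there, and its sign is squeezed between two equal signs.\<close>

lemma thom_interval:
  assumes "thom_eq p s t" "s \<le> u" "u \<le> t"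
  shows "sgn (poly p u) = sgn (poly p s)"
  using assms
proof (induction "degree p" arbitrary: p u rule: less_induct)
  case less
  show ?case
  proof (cases "degree p = 0")
    case True
    then show ?thesis by (auto elim!: degree_eq_zeroE)
  next
    case False
    then have const: "sgn (poly (pderiv p) v) = sgn (poly (pderiv p) s)" if "s \<le> v" "v \<le> t" for v
      using less.hyps[of "pderiv p" v] thom_eq_pderiv less.prems(1) that by (simp add: degree_pderiv)
    have e: "sgn (poly p s) = sgn (poly p t)" using less.prems(1) by (rule thom_eq_sgn)
    show ?thesis
    proof (cases "0 \<le> poly (pderiv p) s")
      case True
      then have nn: "0 \<le> poly (pderiv p) v" if "s \<le> v" "v \<le> t" for v
        using const[OF that] by (auto simp: sgn_if split: if_splits)
      have "poly p s \<le> poly p u" "poly p u \<le> poly p t"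
        using less.prems(2,3) by (auto intro!: poly_mono_if_pderiv_nonneg intro: nn)
      then show ?thesis using sgn_mono_real e by (metis order_antisym)
    next
      case False
      then have nn: "0 \<le> poly (pderiv (-p)) v" if "s \<le> v" "v \<le> t" for v
        using const[OF that] by (auto simp: sgn_if pderiv_minus split: if_splits)
      have "poly (-p) s \<le> poly (-p) u" "poly (-p) u \<le> poly (-p) t"
        using less.prems(2,3) nn by (auto simp del: poly_minus intro!: poly_mono_if_pderiv_nonneg)
      then show ?thesis using sgn_mono_real e by (metis neg_le_iff_le order_antisym poly_minus)
    qed
  qed
qed

text \<open>By Thom's lemma the polynomial would otherwise vanish on a whole interval.\<close>

lemma thom_root_unique:
  assumes "p \<noteq> 0" "poly p s = 0" "thom_eq p s t"
  shows "s = t"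
proof -
  have *: False if "thom_eq p a b" "a < b" "poly p a = 0" for a b
  proof -
    have "poly p u = 0" if "a \<le> u" "u \<le> b" for u
      using thom_interval[OF \<open>thom_eq p a b\<close> that] \<open>poly p a = 0\<close> by (simp add: sgn_0_0)
    then show False using poly_zero_if_zero_on_interval \<open>a < b\<close> assms(1) by blast
  qed
  have "thom_eq p t s" using assms(3) by (simp add: thom_eq_def)
  moreover have "poly p t = 0" using thom_eq_sgn[OF assms(3)] assms(2) by (simp add: sgn_0_0)
  ultimately show ?thesis using *[of s t] *[of t s] assms by (metis linorder_neqE)
qed

text \<open>A nonconstant polynomial is unbounded near \<open>-\<infinity>\<close>, and if it increases there it can only
  tend to \<open>-\<infinity>\<close>.\<close>

lemma poly_negative_to_the_left:
  fixes q :: "real poly"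
  assumes "degree q > 0" "\<And>u. u \<le> u0 \<Longrightarrow> poly (pderiv q) u \<ge> 0"
  shows "\<exists>z<u0. poly q z < 0"
proof -
  obtain a r where q: "q = pCons a r" by (cases q)
  with assms(1) have "r \<noteq> 0" by auto
  from poly_infinity[OF this, of "\<bar>poly q u0\<bar> + 1" a] obtain R
    where R: "\<And>z. R \<le> \<bar>z\<bar> \<Longrightarrow> \<bar>poly q u0\<bar> + 1 \<le> \<bar>poly q z\<bar>" unfolding q by auto
  define z where "z = - \<bar>R\<bar> - \<bar>u0\<bar> - 1"
  have "z < u0" unfolding z_def by linarith
  then have "poly q z \<le> poly q u0" using assms(2) by (intro poly_mono_if_pderiv_nonneg) auto
  moreover have "\<bar>poly q u0\<bar> + 1 \<le> \<bar>poly q z\<bar>" by (rule R) (simp add: z_def)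
  ultimately have "poly q z < 0" by linarith
  with \<open>z < u0\<close> show ?thesis by blast
qed

text \<open>The univariate core of quantifier elimination. \<open>W\<close> and \<open>g ` W\<close> are two finite sets of
  marked points, matched by \<open>g\<close> in an order-preserving way, that contain all critical points of
  \<open>q\<close> and \<open>p\<close>; the samples \<open>u0\<close> and \<open>t\<close> lie in corresponding gaps. If \<open>p\<close> and \<open>q\<close> have equal
  signs at matched points and their derivatives have equal signs at the samples, then each sign of
  \<open>p\<close> at a point of its gap is also taken by \<open>q\<close> in the corresponding gap.

  Here both increase in these gaps, and \<open>q\<close> has to take a smaller sign than at \<open>u0\<close>. At the left end of
  the gap of \<open>p\<close>, if there is one, \<open>p\<close> is smaller than at \<open>t\<close>, hence negative, so \<open>q\<close> is negative
  at the matched end of its own gap; if there is none, \<open>q\<close> tends to \<open>-\<infinity>\<close>. The wanted sign is then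
  taken by the intermediate value theorem.\<close>

lemma gap_sign_transfer_leftwards:
  fixes p q :: "real poly" and g :: "real \<Rightarrow> real"
  assumes W: "finite W" "\<And>a. poly (pderiv q) a = 0 \<Longrightarrow> a \<in> W" "u0 \<notin> W"
    and Z: "\<And>a. poly (pderiv p) a = 0 \<Longrightarrow> a \<in> g ` W" "t \<notin> g ` W"
    and deg: "degree q > 0"
    and g: "\<And>a b. a \<in> W \<Longrightarrow> b \<in> W \<Longrightarrow> a < b \<longleftrightarrow> g a < g b"
           "\<And>a. a \<in> W \<Longrightarrow> sgn (poly q a) = sgn (poly p (g a))"
           "\<And>a. a \<in> W \<Longrightarrow> a < u0 \<longleftrightarrow> g a < t"
    and pos: "poly (pderiv p) t > 0" "poly (pderiv q) u0 > 0"
    and lt: "sgn (poly p t) < sgn (poly q u0)"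
  shows "\<exists>u. sgn (poly q u) = sgn (poly p t) \<and> (\<forall>a\<in>W. a \<noteq> u \<and> (a < u \<longleftrightarrow> a < u0))"
proof -
  have "\<exists>z<u0. poly q z < 0 \<and> (\<forall>a\<in>W. a < u0 \<longrightarrow> a \<le> z)"
  proof (cases "W \<inter> {..<u0} = {}")
    case True
    have "poly (pderiv q) u \<ge> 0" if "u \<le> u0" for u
    proof -
      have "sgn (poly (pderiv q) u) = sgn (poly (pderiv q) u0)"
        using True W(2,3) that by (intro poly_sgn_constant_if_no_root)
          (metis IntI emptyE lessThan_iff max.absorb2 order_less_le)
      then show ?thesis using pos(2) by (auto simp: sgn_if split: if_splits)
    qed
    then have "\<exists>z<u0. poly q z < 0" by (rule poly_negative_to_the_left[OF deg])
    with True show ?thesis by auto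
  next
    case False
    define a where "a = Max (W \<inter> {..<u0})"
    have "a \<in> W \<inter> {..<u0}" unfolding a_def using False W(1) by (intro Max_in) auto
    then have a: "a \<in> W" "a < u0" by auto
    have amax: "b \<le> a" if "b \<in> W" "b < u0" for b
      unfolding a_def using W(1) that by (intro Max_ge) auto
    have gat: "g a < t" using g(3) a by blast
    have d: "poly (pderiv p) u > 0" if "g a < u" "u \<le> t" for u
    proof -
      have "poly (pderiv p) v \<noteq> 0" if v: "g a < v" "v \<le> t" for v
      proof
        assume "poly (pderiv p) v = 0"
        then obtain c where c: "c \<in> W" "v = g c" using Z(1) by auto
        then have "v \<noteq> t" using Z(2) by auto
        with c v have "c < u0" "a < c" using g(1)[OF a(1) c(1)] g(3)[OF c(1)] by auto
        then show False using amax c by force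
      qed
      then have "sgn (poly (pderiv p) u) = sgn (poly (pderiv p) t)"
        using that by (intro poly_sgn_constant_if_no_root) (auto simp: min_def max_def)
      with pos(1) show ?thesis by (auto simp: sgn_if split: if_splits)
    qed
    obtain v where v: "g a < v" "v < t" "poly p t - poly p (g a) = (t - g a) * poly (pderiv p) v"
      using poly_MVT[OF gat, of p] by blast
    have "poly p (g a) < poly p t"
      using v d[of v] gat by (smt (verit) mult_pos_pos)
    with lt have "poly p (g a) < 0" by (auto simp: sgn_if split: if_splits)
    with g(2)[OF a(1)] have "poly q a < 0" by (auto simp: sgn_if split: if_splits)
    with a amax show ?thesis by blast
  qed
  then obtain z where z: "z < u0" "poly q z < 0" "\<And>a. a \<in> W \<Longrightarrow> a < u0 \<Longrightarrow> a \<le> z" by blast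
  \<comment> \<open>A value with the wanted sign strictly above \<open>poly q z\<close>, so that it is taken inside the gap.\<close>
  define v where "v = (if poly p t = 0 then 0 else poly q z / 2)"
  have v: "sgn v = sgn (poly p t)" "poly q z < v" "v \<le> poly q u0"
    using lt z(2) by (auto simp: v_def sgn_if split: if_splits)
  obtain u where u: "z \<le> u" "u \<le> u0" "poly q u = v"
    using IVT[of "poly q" z v u0] v z by auto
  then have "z < u" using v(2) by (metis order_le_less order_less_irrefl)
  have "\<forall>a\<in>W. a \<noteq> u \<and> (a < u \<longleftrightarrow> a < u0)"
    using \<open>z < u\<close> u(2) z(3) W(3) by (metis dual_order.strict_trans1 linorder_not_less order_less_le)
  with u v show ?thesis by blast
qed

text \<open>The reflection \<open>s \<mapsto> - f (- s)\<close> keeps derivatives positive and reverses both the order of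
  points and the signs of values, so a search to the right becomes one to the left.\<close>

lemma gap_sign_transfer_increasing:
  fixes p q :: "real poly" and g :: "real \<Rightarrow> real"
  assumes W: "finite W" "\<And>a. poly (pderiv q) a = 0 \<Longrightarrow> a \<in> W" "u0 \<notin> W"
    and Z: "\<And>a. poly (pderiv p) a = 0 \<Longrightarrow> a \<in> g ` W" "t \<notin> g ` W"
    and deg: "degree q > 0"
    and g: "\<And>a b. a \<in> W \<Longrightarrow> b \<in> W \<Longrightarrow> a < b \<longleftrightarrow> g a < g b"
           "\<And>a. a \<in> W \<Longrightarrow> sgn (poly q a) = sgn (poly p (g a))"
           "\<And>a. a \<in> W \<Longrightarrow> a < u0 \<longleftrightarrow> g a < t"
    and pos: "poly (pderiv p) t > 0" "poly (pderiv q) u0 > 0"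
  shows "\<exists>u. sgn (poly q u) = sgn (poly p t) \<and> (\<forall>a\<in>W. a \<noteq> u \<and> (a < u \<longleftrightarrow> a < u0))"
proof (cases "sgn (poly p t)" "sgn (poly q u0)" rule: linorder_cases)
  case less
  show ?thesis by (rule gap_sign_transfer_leftwards[where g = g and p = p]) (fact | use assms less in blast)+
next
  case equal
  then show ?thesis using W(3) by (intro exI[of _ u0]) auto
next
  case greater
  define r where "r = (\<lambda>f :: real poly. - pcompose f [:0, -1:])"
  have r: "poly (r f) s = - poly f (- s)" for f s by (simp add: r_def poly_pcompose)
  have rd: "poly (pderiv (r f)) s = poly (pderiv f) (- s)" for f s
    by (simp add: r_def pderiv_pcompose pderiv_minus poly_pcompose pderiv_pCons)
  have "\<exists>u. sgn (poly (r q) u) = sgn (poly (r p) (-t)) \<and> (\<forall>a\<in>uminus ` W. a \<noteq> u \<and> (a < u \<longleftrightarrow> a < -u0))"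
  proof (rule gap_sign_transfer_leftwards[where g = "\<lambda>a. - g (- a)" and p = "r p"])
    show "degree (r q) > 0" using deg by (simp add: r_def degree_pcompose)
    show "a \<in> uminus ` W" if "poly (pderiv (r q)) a = 0" for a
      using W(2)[of "-a"] that by (force simp: rd)
    show "a \<in> (\<lambda>a. - g (- a)) ` uminus ` W" if "poly (pderiv (r p)) a = 0" for a
      using Z(1)[of "-a"] that by (force simp: rd image_image)
    show "a < - u0 \<longleftrightarrow> - g (- a) < - t" if aW: "a \<in> uminus ` W" for a
    proof -
      obtain b where b: "b \<in> W" "a = - b" using aW by blast
      have "b \<noteq> u0" "g b \<noteq> t" using b W(3) Z(2) by auto
      then show ?thesis using g(3)[OF b(1)] b(2) by auto
    qed
  qed (use assms greater in \<open>auto simp: r rd sgn_minus\<close>)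
  then obtain u where u: "sgn (poly (r q) u) = sgn (poly (r p) (-t))"
    "\<And>a. a \<in> uminus ` W \<Longrightarrow> a \<noteq> u \<and> (a < u \<longleftrightarrow> a < -u0)" by blast
  have "a \<noteq> -u \<and> (a < - u \<longleftrightarrow> a < u0)" if "a \<in> W" for a
    using u(2)[of "-a"] that W(3) by (metis imageI linorder_neqE minus_minus neg_less_iff_less order_less_asym)
  then show ?thesis using u(1) by (intro exI[of _ "-u"]) (auto simp: r sgn_minus)
qed

text \<open>Passing to \<open>- p\<close> and \<open>- q\<close> removes the assumption of monotone increase.\<close>

lemma gap_sign_transfer:
  fixes p q :: "real poly" and g :: "real \<Rightarrow> real"
  assumes W: "finite W" "\<And>a. poly (pderiv q) a = 0 \<Longrightarrow> a \<in> W" "u0 \<notin> W"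
    and Z: "\<And>a. poly (pderiv p) a = 0 \<Longrightarrow> a \<in> g ` W" "t \<notin> g ` W"
    and deg: "degree q > 0"
    and g: "\<And>a b. a \<in> W \<Longrightarrow> b \<in> W \<Longrightarrow> a < b \<longleftrightarrow> g a < g b"
           "\<And>a. a \<in> W \<Longrightarrow> sgn (poly q a) = sgn (poly p (g a))"
           "\<And>a. a \<in> W \<Longrightarrow> a < u0 \<longleftrightarrow> g a < t"
    and d: "sgn (poly (pderiv p) t) = sgn (poly (pderiv q) u0)"
  shows "\<exists>u. sgn (poly q u) = sgn (poly p t) \<and> (\<forall>a\<in>W. a \<noteq> u \<and> (a < u \<longleftrightarrow> a < u0))"
proof -
  have "poly (pderiv q) u0 \<noteq> 0" using W by auto
  then consider "poly (pderiv q) u0 > 0" | "poly (pderiv q) u0 < 0" by linarith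
  then show ?thesis
  proof cases
    case 1
    with d have "poly (pderiv p) t > 0" by (auto simp: sgn_if split: if_splits)
    with 1 show ?thesis by (intro gap_sign_transfer_increasing[where g = g and p = p]) (use assms in blast)+
  next
    case 2
    with d have "poly (pderiv p) t < 0" by (auto simp: sgn_if split: if_splits)
    have "\<exists>u. sgn (poly (-q) u) = sgn (poly (-p) t) \<and> (\<forall>a\<in>W. a \<noteq> u \<and> (a < u \<longleftrightarrow> a < u0))"
      by (rule gap_sign_transfer_increasing[where g = g and p = "-p"])
        (use assms 2 \<open>poly (pderiv p) t < 0\<close> in \<open>auto simp: pderiv_minus sgn_minus\<close>)
    then show ?thesis by (simp add: sgn_minus)
  qed
qed

section \<open>Sign patterns of families of polynomials\<close>

type_synonym 'x pfam = "'x \<Rightarrow> real poly"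

text \<open>The polynomials of \<open>F\<close> have the same sign pattern at the point \<open>t\<close> over \<open>x\<close> and at the
  point \<open>u\<close> over \<open>y\<close>. Patterns are only ever compared, so they need not be objects themselves.\<close>

definition agree :: "'x pfam set \<Rightarrow> 'x \<Rightarrow> real \<Rightarrow> 'x \<Rightarrow> real \<Rightarrow> bool" where
  "agree F x t y u \<longleftrightarrow> (\<forall>P\<in>F. sgn (poly (P x) t) = sgn (poly (P y) u))"

definition patterns_subset :: "'x pfam set \<Rightarrow> 'x \<Rightarrow> 'x \<Rightarrow> bool" where
  "patterns_subset F x y \<longleftrightarrow> (\<forall>t. \<exists>u. agree F x t y u)"

definition pder :: "'x pfam \<Rightarrow> 'x pfam" where
  "pder P = (\<lambda>x. pderiv (P x))"

definition pder_closed :: "'x pfam set \<Rightarrow> bool" where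
  "pder_closed F \<longleftrightarrow> (\<forall>P\<in>F. pder P \<in> F)"

definition roots_at :: "'x pfam set \<Rightarrow> 'x \<Rightarrow> real set" where
  "roots_at F x = {a. \<exists>Q\<in>F. Q x \<noteq> 0 \<and> poly (Q x) a = 0}"

lemma agree_sym: "agree F x t y u \<Longrightarrow> agree F y u x t"
  by (simp add: agree_def)

lemma agree_trans: "agree F x t y u \<Longrightarrow> agree F y u z v \<Longrightarrow> agree F x t z v"
  by (simp add: agree_def)

lemma agree_mono: "agree G x t y u \<Longrightarrow> F \<subseteq> G \<Longrightarrow> agree F x t y u"
  by (auto simp: agree_def)

lemma agreeD: "agree F x t y u \<Longrightarrow> P \<in> F \<Longrightarrow> sgn (poly (P x) t) = sgn (poly (P y) u)"
  by (auto simp: agree_def)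

lemma patterns_subset_mono: "patterns_subset G x y \<Longrightarrow> F \<subseteq> G \<Longrightarrow> patterns_subset F x y"
  unfolding patterns_subset_def by (meson agree_mono)

lemma pder_closed_iterate: "pder_closed F \<Longrightarrow> P \<in> F \<Longrightarrow> (\<lambda>x. (pderiv ^^ k) (P x)) \<in> F"
proof (induction k)
  case (Suc k)
  then have "pder (\<lambda>x. (pderiv ^^ k) (P x)) \<in> F" by (simp add: pder_closed_def)
  then show ?case by (simp add: pder_def)
qed simp

lemma agree_iterate:
  assumes "pder_closed F" "P \<in> F" "agree F x t y u"
  shows "sgn (poly ((pderiv ^^ k) (P x)) t) = sgn (poly ((pderiv ^^ k) (P y)) u)"
  using agreeD[OF assms(3) pder_closed_iterate[OF assms(1,2), of k]] by simp

lemma agree_imp_thom_eq: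
  assumes "pder_closed F" "P \<in> F" "agree F x t x u"
  shows "thom_eq (P x) t u"
  unfolding thom_eq_def
proof
  fix k
  show "sgn (poly ((pderiv ^^ k) (P x)) t) = sgn (poly ((pderiv ^^ k) (P x)) u)"
    by (rule agree_iterate[OF assms])
qed

lemma finite_roots_at: "finite F \<Longrightarrow> finite (roots_at F x)"
proof -
  assume "finite F"
  have "roots_at F x = (\<Union>Q\<in>{Q\<in>F. Q x \<noteq> 0}. {a. poly (Q x) a = 0})"
    by (auto simp: roots_at_def)
  then show ?thesis using \<open>finite F\<close> poly_roots_finite by auto
qed

text \<open>A root is identified among all points over the same parameter by its pattern.\<close>

lemma roots_at_unique:
  assumes "pder_closed F" "a \<in> roots_at F x" "agree F x a x b"
  shows "a = b"
proof -
  obtain Q where "Q \<in> F" "Q x \<noteq> 0" "poly (Q x) a = 0" using assms(2) by (auto simp: roots_at_def)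
  then show ?thesis
    using thom_root_unique[OF _ _ agree_imp_thom_eq[OF assms(1) _ assms(3)]] by blast
qed

definition same_zero :: "'x pfam set \<Rightarrow> 'x \<Rightarrow> 'x \<Rightarrow> bool" where
  "same_zero F x y \<longleftrightarrow> (\<forall>Q\<in>F. Q x = 0 \<longleftrightarrow> Q y = 0)"

lemma same_zero_sym: "same_zero F x y \<Longrightarrow> same_zero F y x"
  by (simp add: same_zero_def)

lemma agree_roots_at:
  assumes "same_zero F x y" "agree F x t y u"
  shows "t \<in> roots_at F x \<longleftrightarrow> u \<in> roots_at F y"
proof -
  have "poly (Q x) t = 0 \<longleftrightarrow> poly (Q y) u = 0" if "Q \<in> F" for Q
    using agreeD[OF assms(2) that] by (metis sgn_0_0)
  then show ?thesis using assms(1) by (auto simp: roots_at_def same_zero_def)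
qed

lemma agree_if_no_root_between:
  assumes "\<And>a. a \<in> roots_at F x \<Longrightarrow> a < s \<longleftrightarrow> a < t" "s \<notin> roots_at F x" "t \<notin> roots_at F x"
  shows "agree F x s x t"
  unfolding agree_def
proof
  fix Q assume Q: "Q \<in> F"
  show "sgn (poly (Q x) s) = sgn (poly (Q x) t)"
  proof (cases "Q x = 0")
    case False
    show ?thesis
    proof (rule poly_sgn_constant_if_no_root)
      fix u assume u: "min s t \<le> u" "u \<le> max s t"
      show "poly (Q x) u \<noteq> 0"
      proof
        assume "poly (Q x) u = 0"
        then have "u \<in> roots_at F x" using Q False by (auto simp: roots_at_def)
        then have "u < s \<longleftrightarrow> u < t" "u \<noteq> s" "u \<noteq> t" using assms by auto
        then show False using u by (auto simp: min_def max_def split: if_splits)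
      qed
    qed
  qed simp
qed

text \<open>The order of two points is encoded in their patterns: take a polynomial that distinguishes
  them but none of whose derivatives does. Its derivative then has a constant sign between the
  points, which is part of the pattern, and tells in which direction the polynomial changes.\<close>

lemma thom_order:
  assumes F: "pder_closed F" "P \<in> F"
    and ne: "sgn (poly (P x) s) \<noteq> sgn (poly (P x) t)"
    and s: "agree F x s y s'" and t: "agree F x t y t'" and lt: "s < t"
  shows "s' < t'"
  using F(2) ne
proof (induction "degree (P x)" arbitrary: P rule: less_induct)
  case less
  have d: "degree (P x) > 0"
    using less.prems by (metis degree_eq_zeroE gr0I poly_pCons mult_zero_right poly_0)
  then have d': "degree (pder P x) < degree (P x)" by (simp add: pder_def degree_pderiv)
  have P': "pder P \<in> F" using F(1) less.prems by (simp add: pder_closed_def)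
  have k: "(\<lambda>x. (pderiv ^^ k) (pder P x)) \<in> F" for k
    by (rule pder_closed_iterate[OF F(1) P'])
  have dk: "degree ((pderiv ^^ k) (pder P x)) < degree (P x)" for k
  proof -
    have "degree ((pderiv ^^ k) (pder P x)) \<le> degree (pder P x)"
      by (induction k) (auto simp: degree_pderiv)
    with d' show ?thesis by simp
  qed
  show ?case
  proof (cases "\<exists>k. sgn (poly ((pderiv ^^ k) (pder P x)) s) \<noteq> sgn (poly ((pderiv ^^ k) (pder P x)) t)")
    case True
    then obtain j where "sgn (poly ((pderiv ^^ j) (pder P x)) s) \<noteq> sgn (poly ((pderiv ^^ j) (pder P x)) t)" by blast
    then show ?thesis by (rule less.hyps[OF dk k])
  next
    case False
    then have tx: "thom_eq (pderiv (P x)) s t" by (auto simp: thom_eq_def pder_def)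
    have k': "sgn (poly ((pderiv ^^ j) (pder P y)) s') = sgn (poly ((pderiv ^^ j) (pder P y)) t')" for j
      using False agreeD[OF s k] agreeD[OF t k] by metis
    then have ty: "thom_eq (pderiv (P y)) s' t'" "thom_eq (pderiv (P y)) t' s'"
      by (auto simp: thom_eq_def pder_def)
    have es: "sgn (poly (pderiv (P x)) s) = sgn (poly (pderiv (P y)) s')"
      using agreeD[OF s P'] by (simp add: pder_def)
    have e0: "sgn (poly (pderiv (P y)) s') = sgn (poly (pderiv (P y)) t')"
      by (rule thom_eq_sgn[OF ty(1)])
    have sP: "sgn (poly (P x) s) = sgn (poly (P y) s')" and tP: "sgn (poly (P x) t) = sgn (poly (P y) t')"
      using agreeD[OF s] agreeD[OF t] less.prems by auto
    show ?thesis
    proof (rule ccontr)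
      assume "\<not> s' < t'"
      then have le: "t' \<le> s'" by simp
      define e :: real where "e = (if poly (pderiv (P x)) s \<ge> 0 then 1 else -1)"
      have pd: "poly (pderiv (smult e p)) v = e * poly (pderiv p) v" for p v
        by (simp add: pderiv_smult)
      have "poly (smult e (P x)) s \<le> poly (smult e (P x)) t"
      proof (rule poly_mono_if_pderiv_nonneg)
        fix u assume "s \<le> u" "u \<le> t"
        then show "0 \<le> poly (pderiv (smult e (P x))) u"
          using thom_interval[OF tx, of u] unfolding pd unfolding e_def by (auto simp: sgn_if split: if_splits)
      qed (use lt in simp)
      moreover have "poly (smult e (P y)) t' \<le> poly (smult e (P y)) s'"
      proof (rule poly_mono_if_pderiv_nonneg[OF le])
        fix u assume "t' \<le> u" "u \<le> s'"
        then show "0 \<le> poly (pderiv (smult e (P y))) u"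
          using thom_interval[OF ty(2), of u] es e0 unfolding pd unfolding e_def by (auto simp: sgn_if split: if_splits)
      qed
      ultimately show False using sP tP less.prems(2) unfolding e_def
        by (auto simp: sgn_if split: if_splits)
    qed
  qed
qed

lemma thom_order_iff:
  assumes F: "pder_closed F" and ne: "\<not> agree F x s x t"
    and s: "agree F x s y s'" and t: "agree F x t y t'"
  shows "s < t \<longleftrightarrow> s' < t'"
proof -
  obtain P where P: "P \<in> F" "sgn (poly (P x) s) \<noteq> sgn (poly (P x) t)"
    using ne by (auto simp: agree_def)
  have "sgn (poly (P y) s') \<noteq> sgn (poly (P y) t')"
    using P agreeD[OF s P(1)] agreeD[OF t P(1)] by simp
  then show ?thesis
    using thom_order[OF F P(1) P(2) s t] thom_order[OF F P(1) _ agree_sym[OF s] agree_sym[OF t]] by blast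
qed

text \<open>The step of the elimination. \<open>F\<close> contains the derivative of the new family \<open>P\<close>, and \<open>G\<close>
  supplies, for every \<open>Q\<close> in \<open>F\<close>, some \<open>r\<close> with the sign of \<open>P\<close> at the roots of \<open>Q\<close>. Roots of \<open>F\<close>
  over \<open>x\<close> and \<open>y\<close> are matched by their patterns, monotonically by \<open>thom_order_iff\<close>. At a root of
  \<open>F\<close> the sign of \<open>P\<close> is read off \<open>r\<close>; between roots \<open>gap_sign_transfer\<close> applies.\<close>

lemma patterns_subset_insert:
  fixes x y :: 'x
  assumes fin: "finite F" and F: "pder_closed F" and sub: "F \<subseteq> G"
    and xy: "patterns_subset G x y" and yx: "patterns_subset G y x"
    and P': "pder P \<in> F" and deg: "degree (P x) > 0" "degree (P y) > 0"
    and zero: "same_zero F x y"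
    and red: "\<And>Q. Q \<in> F \<Longrightarrow> Q x \<noteq> 0 \<Longrightarrow> \<exists>r\<in>G. \<forall>z\<in>{x,y}. \<forall>t. poly (Q z) t = 0 \<longrightarrow>
              sgn (poly (P z) t) = sgn (poly (r z) t)"
  shows "patterns_subset (insert P F) x y"
  unfolding patterns_subset_def
proof
  fix t
  have root: "sgn (poly (P x) a) = sgn (poly (P y) b)"
    if "a \<in> roots_at F x" "agree G x a y b" for a b
  proof -
    obtain Q where Q: "Q \<in> F" "Q x \<noteq> 0" "poly (Q x) a = 0" using \<open>a \<in> roots_at F x\<close> by (auto simp: roots_at_def)
    then have Qy: "poly (Q y) b = 0" using agreeD[OF that(2), of Q] sub by (auto simp: sgn_0_0)
    from red[OF Q(1,2)] obtain r where "r \<in> G"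
      "\<forall>z\<in>{x,y}. \<forall>t. poly (Q z) t = 0 \<longrightarrow> sgn (poly (P z) t) = sgn (poly (r z) t)" by blast
    then show ?thesis using Q Qy agreeD[OF that(2), of r] by simp
  qed
  obtain u0 where u0: "agree G x t y u0" using xy by (auto simp: patterns_subset_def)
  have u0F: "agree F x t y u0" using agree_mono[OF u0 sub] .
  show "\<exists>u. agree (insert P F) x t y u"
  proof (cases "t \<in> roots_at F x")
    case True
    then show ?thesis using root[OF True u0] u0F by (auto simp: agree_def)
  next
    case False
    then have u0W: "u0 \<notin> roots_at F y" using agree_roots_at[OF zero u0F] by simp
    obtain g where g: "\<And>a. agree G y a x (g a)" using yx unfolding patterns_subset_def by metis
    have gF: "agree F y a x (g a)" for a using agree_mono[OF g sub] .
    let ?W = "roots_at F y"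
    have gW: "g ` ?W = roots_at F x"
    proof
      show "g ` ?W \<subseteq> roots_at F x" using agree_roots_at[OF same_zero_sym[OF zero] gF] by auto
      show "roots_at F x \<subseteq> g ` ?W"
      proof
        fix c assume c: "c \<in> roots_at F x"
        obtain c' where c': "agree G x c y c'" using xy by (auto simp: patterns_subset_def)
        then have "c' \<in> ?W" using agree_roots_at[OF zero agree_mono[OF c' sub]] c by simp
        moreover have "g c' = c" using roots_at_unique[OF F c agree_trans[OF agree_mono[OF c' sub] gF]] by simp
        ultimately show "c \<in> g ` ?W" by blast
      qed
    qed
    have zx: "pderiv (P x) \<noteq> 0" "pderiv (P y) \<noteq> 0" using deg by (auto simp: pderiv_eq_0_iff)
    have "\<exists>u. sgn (poly (P y) u) = sgn (poly (P x) t) \<and> (\<forall>a\<in>?W. a \<noteq> u \<and> (a < u \<longleftrightarrow> a < u0))"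
    proof (rule gap_sign_transfer[where g = g])
      show "finite ?W" using fin by (rule finite_roots_at)
      show "a \<in> ?W" if "poly (pderiv (P y)) a = 0" for a
        using that zx P' by (auto simp: roots_at_def pder_def intro!: bexI[of _ "pder P"])
      show "a \<in> g ` ?W" if "poly (pderiv (P x)) a = 0" for a
        unfolding gW using that zx P' by (auto simp: roots_at_def pder_def intro!: bexI[of _ "pder P"])
      show "a < b \<longleftrightarrow> g a < g b" if "a \<in> ?W" "b \<in> ?W" for a b
      proof (cases "a = b")
        case False
        then have "\<not> agree F y a y b" using roots_at_unique[OF F that(1)] by blast
        then show ?thesis by (rule thom_order_iff[OF F _ gF gF])
      qed simp
      show "a < u0 \<longleftrightarrow> g a < t" if "a \<in> ?W" for a
      proof -
        have "\<not> agree F y a y u0" using roots_at_unique[OF F that] u0W that by blast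
        then show ?thesis by (rule thom_order_iff[OF F _ gF agree_sym[OF u0F]])
      qed
      show "sgn (poly (P y) a) = sgn (poly (P x) (g a))" if "a \<in> ?W" for a
        using root[OF _ agree_sym[OF g]] gW that by (metis imageI)
      show "sgn (poly (pderiv (P x)) t) = sgn (poly (pderiv (P y)) u0)"
        using agreeD[OF u0F P'] by (simp add: pder_def)
    qed (use u0W deg False gW in auto)
    then obtain u where u: "sgn (poly (P y) u) = sgn (poly (P x) t)"
      "\<And>a. a \<in> ?W \<Longrightarrow> a \<noteq> u \<and> (a < u \<longleftrightarrow> a < u0)" by blast
    have "agree F y u y u0" using u(2) u0W by (intro agree_if_no_root_between) auto
    then have "agree F x t y u" using agree_trans[OF u0F agree_sym] by blast
    with u(1) show ?thesis by (intro exI[of _ u]) (auto simp: agree_def)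
  qed
qed

section \<open>Polynomials in finitely many variables\<close>

type_synonym env = "nat \<Rightarrow> real"

text \<open>Polynomial functions in the variables \<open>x 0, \<dots>, x (n - 1)\<close>. Infinite sequences serve as
  points, so that the number of variables can change along an induction while the type stays the same.\<close>

inductive_set pol :: "nat \<Rightarrow> (env \<Rightarrow> real) set" for n where
  const: "(\<lambda>x. c) \<in> pol n"
| var: "i < n \<Longrightarrow> (\<lambda>x. x i) \<in> pol n"
| add: "p \<in> pol n \<Longrightarrow> q \<in> pol n \<Longrightarrow> (\<lambda>x. p x + q x) \<in> pol n"
| mult: "p \<in> pol n \<Longrightarrow> q \<in> pol n \<Longrightarrow> (\<lambda>x. p x * q x) \<in> pol n"

lemma pol_sum: "(\<And>i. i \<in> I \<Longrightarrow> p i \<in> pol n) \<Longrightarrow> (\<lambda>x. \<Sum>i\<in>I. p i x) \<in> pol n"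
  by (induction I rule: infinite_finite_induct) (auto intro: pol.intros)

lemma pol_power: "p \<in> pol n \<Longrightarrow> (\<lambda>x. p x ^ k) \<in> pol n"
  by (induction k) (auto intro: pol.intros)

lemma pol_minus: "p \<in> pol n \<Longrightarrow> (\<lambda>x. - p x) \<in> pol n"
  using pol.mult[OF pol.const[of "-1"]] by simp

lemma pol_diff: "p \<in> pol n \<Longrightarrow> q \<in> pol n \<Longrightarrow> (\<lambda>x. p x - q x) \<in> pol n"
  using pol.add[OF _ pol_minus] by force

lemma pol_mono: "p \<in> pol n \<Longrightarrow> n \<le> m \<Longrightarrow> p \<in> pol m"
  by (induction rule: pol.induct) (auto intro: pol.intros)

lemma pol_cong: "p \<in> pol n \<Longrightarrow> (\<And>i. i < n \<Longrightarrow> x i = y i) \<Longrightarrow> p x = p y"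
  by (induction rule: pol.induct) auto

lemma pol_continuous: "p \<in> pol n \<Longrightarrow> continuous_on UNIV p"
  by (induction rule: pol.induct) (auto intro!: continuous_intros continuous_on_product_coordinates)

text \<open>A polynomial in \<open>n + 1\<close> variables, seen as a polynomial in the last one whose coefficients
  are polynomials in the others.\<close>

definition fam :: "nat \<Rightarrow> env pfam \<Rightarrow> bool" where
  "fam n P \<longleftrightarrow> (\<exists>d. \<forall>x. degree (P x) \<le> d) \<and> (\<forall>i. (\<lambda>x. coeff (P x) i) \<in> pol n)"

lemma fam_cong: "fam n P \<Longrightarrow> (\<And>i. i < n \<Longrightarrow> x i = y i) \<Longrightarrow> P x = P y"
  by (rule poly_eqI) (auto simp: fam_def intro: pol_cong)

lemma fam_pder: "fam n P \<Longrightarrow> fam n (pder P)"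
  unfolding fam_def pder_def by (auto simp: coeff_pderiv degree_pderiv intro!: pol.intros)
    (meson diff_le_self order_trans)

lemma fam_pder_iterate: "fam n P \<Longrightarrow> fam n (\<lambda>x. (pderiv ^^ k) (P x))"
proof (induction k)
  case (Suc k)
  then have "fam n (pder (\<lambda>x. (pderiv ^^ k) (P x)))" by (intro fam_pder)
  then show ?case by (simp add: pder_def)
qed simp

lemma fam_const: "p \<in> pol n \<Longrightarrow> fam n (\<lambda>x. [:p x:])"
proof -
  assume p: "p \<in> pol n"
  have "(\<lambda>x. coeff [:p x:] i) \<in> pol n" for i
    using p by (cases i) (auto intro: pol.const)
  then show ?thesis by (auto simp: fam_def)
qed

lemma fam_add: "fam n P \<Longrightarrow> fam n Q \<Longrightarrow> fam n (\<lambda>x. P x + Q x)"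
proof -
  assume "fam n P" "fam n Q"
  then obtain d e where "\<And>x. degree (P x) \<le> d" "\<And>x. degree (Q x) \<le> e"
    and "\<And>i. (\<lambda>x. coeff (P x) i) \<in> pol n" "\<And>i. (\<lambda>x. coeff (Q x) i) \<in> pol n" by (auto simp: fam_def)
  then have "degree (P x + Q x) \<le> max d e" "(\<lambda>x. coeff (P x) i + coeff (Q x) i) \<in> pol n" for x i
    by (auto intro!: degree_add_le pol.add intro: le_max_iff_disj[THEN iffD2])
  then show ?thesis by (auto simp: fam_def)
qed

lemma fam_mult: assumes "fam n P" "fam n Q" shows "fam n (\<lambda>x. P x * Q x)"
proof -
  from assms obtain d e where "\<And>x. degree (P x) \<le> d" "\<And>x. degree (Q x) \<le> e" by (auto simp: fam_def)
  then have "degree (P x * Q x) \<le> d + e" for x by (meson add_mono degree_mult_le order_trans)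
  moreover have "(\<lambda>x. coeff (P x * Q x) i) \<in> pol n" for i
    unfolding coeff_mult using assms by (intro pol_sum pol.mult) (auto simp: fam_def)
  ultimately show ?thesis by (auto simp: fam_def)
qed

lemma pol_Suc_imp_fam: "p \<in> pol (Suc n) \<Longrightarrow> \<exists>P. fam n P \<and> (\<forall>x. p x = poly (P x) (x n))"
proof (induction rule: pol.induct)
  case (const c)
  then show ?case by (intro exI[of _ "\<lambda>x. [:c:]"]) (auto intro: fam_const pol.const)
next
  case (var i)
  show ?case
  proof (cases "i = n")
    case True
    have "fam n (\<lambda>x. [:0, 1:])" by (auto simp: fam_def intro: pol.const)
    then show ?thesis using True by (intro exI[of _ "\<lambda>x. [:0, 1:]"]) auto
  next
    case False
    then show ?thesis using var by (intro exI[of _ "\<lambda>x. [:x i:]"]) (auto intro: fam_const[OF pol.var])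
  qed
next
  case (add p q)
  then obtain P Q where "fam n P" "fam n Q" "\<forall>x. p x = poly (P x) (x n)" "\<forall>x. q x = poly (Q x) (x n)" by blast
  then show ?case by (intro exI[of _ "\<lambda>x. P x + Q x"]) (auto intro: fam_add)
next
  case (mult p q)
  then obtain P Q where "fam n P" "fam n Q" "\<forall>x. p x = poly (P x) (x n)" "\<forall>x. q x = poly (Q x) (x n)" by blast
  then show ?case by (intro exI[of _ "\<lambda>x. P x * Q x"]) (auto intro: fam_mult)
qed

lemma poly_bounded_sum: "degree (p :: real poly) \<le> d \<Longrightarrow> poly p x = (\<Sum>i\<le>d. coeff p i * x ^ i)"
  unfolding poly_altdef by (rule sum.mono_neutral_left) (auto simp: coeff_eq_0)

lemma fam_imp_pol: assumes "fam n P" "r \<in> pol m" "n \<le> m" shows "(\<lambda>x. poly (P x) (r x)) \<in> pol m"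
proof -
  from assms obtain d where d: "\<And>x. degree (P x) \<le> d" by (auto simp: fam_def)
  show ?thesis unfolding poly_bounded_sum[OF d]
    using assms by (intro pol_sum pol.mult pol_power) (auto simp: fam_def intro: pol_mono)
qed

text \<open>One step of division of \<open>P\<close>, of degree \<open>d\<close>, by \<open>Q\<close>, of degree \<open>e\<close>, without denominators. A
  single step suffices because only the degree has to drop; the factor of \<open>P\<close> is a square, so
  that signs at roots of \<open>Q\<close> are preserved.\<close>

definition reduct :: "nat \<Rightarrow> nat \<Rightarrow> env pfam \<Rightarrow> env pfam \<Rightarrow> env pfam" where
  "reduct d e P Q = (\<lambda>x. [:(coeff (Q x) e)\<^sup>2:] * P x + [:- (coeff (P x) d * coeff (Q x) e):] * (monom 1 (d - e) * Q x))"

lemma fam_reduct: assumes "fam n P" "fam n Q" shows "fam n (reduct d e P Q)"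
proof -
  have "fam n (\<lambda>x. monom 1 (d - e))"
    by (auto simp: fam_def degree_monom_eq intro: pol.const)
  then show ?thesis unfolding reduct_def using assms
    by (intro fam_add fam_mult fam_const pol_power pol_minus pol.mult) (auto simp: fam_def)
qed

lemma degree_reduct:
  assumes "degree (P x) = d" "degree (Q x) = e" "e \<le> d" "d > 0"
  shows "degree (reduct d e P Q x) < d"
proof (rule degree_lessI)
  show "\<forall>k\<ge>d. coeff (reduct d e P Q x) k = 0"
  proof (intro allI impI)
    fix k assume k: "k \<ge> d"
    show "coeff (reduct d e P Q x) k = 0"
    proof (cases "k = d")
      case True
      then show ?thesis using assms by (simp add: reduct_def coeff_monom_mult power2_eq_square)
    next
      case False
      then show ?thesis using k assms by (simp add: reduct_def coeff_monom_mult coeff_eq_0)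
    qed
  qed
qed (use assms in simp)

lemma reduct_sgn_at_root:
  assumes "degree (Q x) = e" "Q x \<noteq> 0" "poly (Q x) t = 0"
  shows "sgn (poly (P x) t) = sgn (poly (reduct d e P Q x) t)"
proof -
  have "poly (reduct d e P Q x) t = (coeff (Q x) e)\<^sup>2 * poly (P x) t"
    using assms(3) by (simp add: reduct_def)
  moreover have "(coeff (Q x) e)\<^sup>2 > 0" using assms(1,2) by auto
  ultimately show ?thesis by (auto simp: sgn_if zero_less_mult_iff)
qed

section \<open>Finitely many signs determine the occurring patterns\<close>

definition same_signs :: "(env \<Rightarrow> real) set \<Rightarrow> env \<Rightarrow> env \<Rightarrow> bool" where
  "same_signs H x y \<longleftrightarrow> (\<forall>h\<in>H. sgn (h x) = sgn (h y))"

lemma same_signs_Un: "same_signs (H \<union> H') x y \<longleftrightarrow> same_signs H x y \<and> same_signs H' x y"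
  by (auto simp: same_signs_def)

lemma same_signs_sym: "same_signs H x y \<Longrightarrow> same_signs H y x"
  by (simp add: same_signs_def)

lemma same_signsD: "same_signs H x y \<Longrightarrow> h \<in> H \<Longrightarrow> sgn (h x) = sgn (h y)"
  by (simp add: same_signs_def)

lemma same_signs_refl: "same_signs H x x"
  by (simp add: same_signs_def)

lemma same_signs_trans: "same_signs H x y \<Longrightarrow> same_signs H y z \<Longrightarrow> same_signs H x z"
  by (simp add: same_signs_def)

lemma finite_sign_classes:
  assumes "finite H"
  shows "finite ((\<lambda>x. {y\<in>A. same_signs H x y}) ` X)"
proof -
  define v where "v = (\<lambda>x. restrict (\<lambda>h. sgn (h x)) H)"
  have "sgn a \<in> {-1, 0, 1}" for a :: real by (auto simp: sgn_if)
  then have "v ` X \<subseteq> PiE H (\<lambda>_. {-1, 0, 1})" unfolding v_def by (intro image_subsetI restrict_PiE_iff[THEN iffD2] ballI)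
  then have fin: "finite (v ` X)" using assms finite_PiE[of H] by (meson finite.emptyI finite.insertI finite_subset)
  have *: "{y\<in>A. same_signs H x y} = {y\<in>A. v x = v y}" for x
  proof -
    have "v x = v y \<longleftrightarrow> same_signs H x y" for y
      unfolding v_def same_signs_def fun_eq_iff restrict_def by auto
    then show ?thesis by simp
  qed
  have "(\<lambda>x. {y\<in>A. same_signs H x y}) ` X = (\<lambda>s. {y\<in>A. s = v y}) ` (v ` X)"
    unfolding * by (simp add: image_image)
  then show ?thesis using fin by simp
qed

text \<open>The restriction to an arbitrary set \<open>A\<close> allows degrees to be fixed: on the sign classes of
  the coefficients they are constant.\<close>

definition determined :: "nat \<Rightarrow> env set \<Rightarrow> env pfam set \<Rightarrow> bool" where
  "determined n A F \<longleftrightarrow> (\<exists>H. finite H \<and> H \<subseteq> pol n \<and> (\<forall>x\<in>A. \<forall>y\<in>A. same_signs H x y \<longrightarrow> patterns_subset F x y))"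

text \<open>There are finitely many sign classes, so the finitely many polynomials that work on each of
  them can be collected.\<close>

lemma determined_split:
  assumes H: "finite H" "H \<subseteq> pol n"
    and cls: "\<And>x. x \<in> A \<Longrightarrow> determined n {y\<in>A. same_signs H x y} F"
  shows "determined n A F"
proof -
  define \<C> where "\<C> = (\<lambda>x. {y\<in>A. same_signs H x y}) ` A"
  have fin: "finite \<C>" unfolding \<C>_def by (rule finite_sign_classes[OF H(1)])
  have "\<forall>C\<in>\<C>. \<exists>H. finite H \<and> H \<subseteq> pol n \<and> (\<forall>x\<in>C. \<forall>y\<in>C. same_signs H x y \<longrightarrow> patterns_subset F x y)"
    using cls by (auto simp: \<C>_def determined_def)
  then obtain K where K: "\<And>C. C \<in> \<C> \<Longrightarrow> finite (K C) \<and> K C \<subseteq> pol n \<and> (\<forall>x\<in>C. \<forall>y\<in>C. same_signs (K C) x y \<longrightarrow> patterns_subset F x y)"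
    by metis
  show ?thesis unfolding determined_def
  proof (intro exI[of _ "H \<union> (\<Union>C\<in>\<C>. K C)"] conjI ballI impI)
    show "finite (H \<union> (\<Union>C\<in>\<C>. K C))" using H fin K by auto
    show "H \<union> (\<Union>C\<in>\<C>. K C) \<subseteq> pol n" using H K by auto
    fix x y assume xy: "x \<in> A" "y \<in> A" and s: "same_signs (H \<union> (\<Union>C\<in>\<C>. K C)) x y"
    define C where "C = {y\<in>A. same_signs H x y}"
    have C: "C \<in> \<C>" "x \<in> C" "y \<in> C"
      using xy s by (auto simp: C_def \<C>_def same_signs_Un same_signs_refl)
    moreover have "same_signs (K C) x y" using s C by (auto simp: same_signs_def)
    ultimately show "patterns_subset F x y" using K by blast
  qed
qed

lemma determined_mono: "determined n A G \<Longrightarrow> F \<subseteq> G \<Longrightarrow> determined n A F"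
  unfolding determined_def by (meson patterns_subset_mono)

lemma coeffs_of_families:
  assumes "finite F" "\<forall>P\<in>F. fam n P"
  shows "\<exists>H. finite H \<and> H \<subseteq> pol n \<and>
    (\<forall>x y. same_signs H x y \<longrightarrow> (\<forall>P\<in>F. degree (P x) = degree (P y) \<and> (P x = 0 \<longleftrightarrow> P y = 0)))"
proof -
  from assms(2) obtain D where D: "\<And>P x. P \<in> F \<Longrightarrow> degree (P x) \<le> D P" unfolding fam_def by metis
  define H where "H = (\<Union>P\<in>F. (\<lambda>i x. coeff (P x) i) ` {..D P})"
  have "finite H" unfolding H_def using assms(1) by auto
  moreover have "H \<subseteq> pol n" unfolding H_def using assms(2) by (auto simp: fam_def)
  moreover have "degree (P x) = degree (P y) \<and> (P x = 0 \<longleftrightarrow> P y = 0)" if s: "same_signs H x y" and P: "P \<in> F" for x y P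
  proof -
    have c: "coeff (P x) i = 0 \<longleftrightarrow> coeff (P y) i = 0" for i
    proof (cases "i \<le> D P")
      case True
      then have "(\<lambda>x. coeff (P x) i) \<in> H" using P by (auto simp: H_def)
      then have "sgn (coeff (P x) i) = sgn (coeff (P y) i)" using same_signsD[OF s, of "\<lambda>x. coeff (P x) i"] by simp
      then show ?thesis by (metis sgn_0_0)
    next
      case False
      then show ?thesis using D[OF P, of x] D[OF P, of y] by (simp add: coeff_eq_0)
    qed
    have "degree (P x) = degree (P y)" unfolding degree_def c ..
    then show ?thesis using c by (metis leading_coeff_0_iff)
  qed
  ultimately show ?thesis by blast
qed

lemma pderiv_iterate_eq_0: "degree p < k \<Longrightarrow> (pderiv ^^ k) p = 0" for p :: "real poly"
proof (induction k arbitrary: p)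
  case (Suc k)
  show ?case
  proof (cases "degree p = 0")
    case True
    then have "pderiv p = 0" by (simp add: pderiv_eq_0_iff)
    moreover have "(pderiv ^^ k) 0 = (0 :: real poly)" by (induction k) auto
    ultimately show ?thesis by (simp add: funpow_Suc_right del: funpow.simps)
  next
    case False
    then have "degree (pderiv p) < k" using Suc.prems by (simp add: degree_pderiv)
    then show ?thesis using Suc.IH by (simp add: funpow_Suc_right del: funpow.simps)
  qed
qed simp

lemma degree_pderiv_iterate_le: "degree ((pderiv ^^ k) p) \<le> degree (p :: real poly)"
  by (induction k) (auto simp: degree_pderiv)

text \<open>Derivatives beyond the degree bound vanish, so the closure of a finite family is finite.\<close>

lemma pder_closure:
  assumes "finite F" "\<forall>P\<in>F. fam n P"
  shows "\<exists>F'. finite F' \<and> F \<subseteq> F' \<and> pder_closed F' \<and> (\<forall>P\<in>F'. fam n P) \<and>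
     (\<forall>P'\<in>F'. \<exists>P\<in>F. \<forall>x. degree (P' x) \<le> degree (P x))"
proof -
  from assms(2) obtain D where D: "\<And>P x. P \<in> F \<Longrightarrow> degree (P x) \<le> D P" unfolding fam_def by metis
  define F' where "F' = (\<Union>P\<in>F. (\<lambda>k x. (pderiv ^^ k) (P x)) ` {..Suc (D P)})"
  have "finite F'" unfolding F'_def using assms(1) by auto
  moreover have "F \<subseteq> F'"
  proof
    fix P assume "P \<in> F"
    moreover have "P = (\<lambda>x. (pderiv ^^ 0) (P x))" by simp
    ultimately show "P \<in> F'" unfolding F'_def by blast
  qed
  moreover have "pder_closed F'"
    unfolding pder_closed_def
  proof
    fix Q assume "Q \<in> F'"
    then obtain P k where P: "P \<in> F" "k \<le> Suc (D P)" "Q = (\<lambda>x. (pderiv ^^ k) (P x))" by (auto simp: F'_def)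
    have e: "pder Q = (\<lambda>x. (pderiv ^^ Suc k) (P x))" by (simp add: pder_def P(3))
    show "pder Q \<in> F'"
    proof (cases "k = Suc (D P)")
      case True
      have "(pderiv ^^ j) (P x) = 0" if "j \<ge> k" for j x
        using D[OF P(1), of x] True that by (intro pderiv_iterate_eq_0) simp
      then have "pder Q = (\<lambda>x. (pderiv ^^ k) (P x))" unfolding e by (metis le_SucI order_refl)
      then show ?thesis unfolding F'_def using P by blast
    next
      case False
      then show ?thesis unfolding F'_def e using P by (intro UN_I[of P] imageI) auto
    qed
  qed
  moreover have "\<forall>P\<in>F'. fam n P" unfolding F'_def using assms(2) fam_pder_iterate by auto
  moreover have "\<forall>P'\<in>F'. \<exists>P\<in>F. \<forall>x. degree (P' x) \<le> degree (P x)"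
    unfolding F'_def by (auto intro!: bexI degree_pderiv_iterate_le)
  ultimately show ?thesis by blast
qed

text \<open>The members of degree exactly \<open>D\<close> are added one at a time. For a new one, \<open>P\<close>, the reducts of
  \<open>P\<close> modulo the other members and all derivatives have degree below \<open>D\<close>; putting them into \<open>L\<close>
  leaves fewer members of degree \<open>D\<close>.\<close>

lemma determined_step:
  assumes IH: "\<And>A F. finite F \<Longrightarrow> (\<And>P. P \<in> F \<Longrightarrow> fam n P) \<Longrightarrow> (\<And>P x. P \<in> F \<Longrightarrow> x \<in> A \<Longrightarrow> degree (P x) < D) \<Longrightarrow> determined n A F"
    and D: "D > 0"
    and T: "finite T" "\<And>P. P \<in> T \<Longrightarrow> fam n P" "\<And>P x. P \<in> T \<Longrightarrow> x \<in> A \<Longrightarrow> degree (P x) = D"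
    and L: "finite L" "\<And>P. P \<in> L \<Longrightarrow> fam n P" "\<And>P x. P \<in> L \<Longrightarrow> x \<in> A \<Longrightarrow> degree (P x) < D"
  shows "determined n A (T \<union> L)"
  using T L
proof (induction T arbitrary: A L rule: finite_induct)
  case empty
  then show ?case using IH by simp
next
  case (insert P T)
  let ?L = "L \<union> pder ` insert P T"
  have Ldeg: "degree (Q x) < D" if "Q \<in> ?L" "x \<in> A" for Q x
    using that insert.prems D by (auto simp: pder_def degree_pderiv)
  have fin: "finite ?L" and fam: "\<forall>Q\<in>?L. fam n Q" using insert by (auto intro: fam_pder)
  from pder_closure[OF fin fam] obtain L1
    where L1: "finite L1" "?L \<subseteq> L1" "pder_closed L1" "\<forall>Q\<in>L1. fam n Q"
    "\<forall>Q'\<in>L1. \<exists>Q\<in>?L. \<forall>x. degree (Q' x) \<le> degree (Q x)"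
    by (elim exE conjE) (rule that)
  have L1deg: "degree (Q x) < D" if Q: "Q \<in> L1" and x: "x \<in> A" for Q x
  proof -
    from bspec[OF L1(5) Q] obtain Q' where Q': "Q' \<in> ?L" "\<forall>x. degree (Q x) \<le> degree (Q' x)"
      by (elim bexE) (rule that)
    then show ?thesis using Ldeg[OF Q'(1) x] by (meson le_less_trans)
  qed
  define F0 where "F0 = T \<union> L1"
  have F0: "finite F0" "\<forall>Q\<in>F0. fam n Q" "pder_closed F0" "pder P \<in> F0"
    using insert L1 by (auto simp: F0_def pder_closed_def)
  have F0deg: "degree (Q x) \<le> D" if "Q \<in> F0" "x \<in> A" for Q x
    using that L1deg[of Q x] insert.prems(2)[of Q x] by (auto simp: F0_def)
  from coeffs_of_families[OF F0(1,2)] obtain H where H: "finite H" "H \<subseteq> pol n"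
    "\<forall>x y. same_signs H x y \<longrightarrow> (\<forall>Q\<in>F0. degree (Q x) = degree (Q y) \<and> (Q x = 0 \<longleftrightarrow> Q y = 0))"
    by (elim exE conjE) (rule that)
  \<comment> \<open>Fix the degrees, on which the shape of the reducts depends, by passing to sign classes of coefficients.\<close>
  have "determined n A (insert P F0)"
  proof (rule determined_split[OF H(1,2)])
    fix x0 assume x0: "x0 \<in> A"
    define B where "B = {y\<in>A. same_signs H x0 y}"
    define r where "r Q = reduct D (degree (Q x0)) P Q" for Q :: "env pfam"
    have Bd: "degree (Q y) = degree (Q x0)" if "y \<in> B" "Q \<in> F0" for y Q
      using H(3) that unfolding B_def by (metis (mono_tags, lifting) mem_Collect_eq)
    have Pd: "degree (P y) = D" if "y \<in> B" for y using insert.prems(2) that by (auto simp: B_def)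
    have "determined n B (T \<union> (L1 \<union> r ` F0))"
    proof (rule insert.IH)
      show "fam n Q" if "Q \<in> L1 \<union> r ` F0" for Q
        using that L1(4) F0(2) insert.prems(1) by (auto simp: r_def intro!: fam_reduct)
      show "degree (Q x) < D" if Q: "Q \<in> L1 \<union> r ` F0" and x: "x \<in> B" for Q x
        using Q
      proof
        assume "Q \<in> L1" then show ?thesis using L1deg x by (auto simp: B_def)
      next
        assume "Q \<in> r ` F0"
        then obtain Q' where Q': "Q' \<in> F0" "Q = r Q'" by auto
        show ?thesis unfolding Q'(2) r_def
          by (rule degree_reduct) (use Pd[OF x] Bd[OF x Q'(1)] F0deg[OF Q'(1) x0] D in auto)
      qed
    qed (use insert.prems insert.hyps L1(1) F0(1) in \<open>auto simp: B_def\<close>)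
    then obtain H' where H': "finite H'" "H' \<subseteq> pol n"
      "\<And>x y. x \<in> B \<Longrightarrow> y \<in> B \<Longrightarrow> same_signs H' x y \<Longrightarrow> patterns_subset (T \<union> (L1 \<union> r ` F0)) x y"
      unfolding determined_def by blast
    have "patterns_subset (insert P F0) x y" if xy: "x \<in> B" "y \<in> B" "same_signs H' x y" for x y
    proof (rule patterns_subset_insert[where G = "T \<union> (L1 \<union> r ` F0)"])
      show "patterns_subset (T \<union> (L1 \<union> r ` F0)) x y" "patterns_subset (T \<union> (L1 \<union> r ` F0)) y x"
        using H'(3) xy same_signs_sym by blast+
      show "same_zero F0 x y"
        using H(3) same_signs_trans[OF same_signs_sym[of H x0 x], of y] xy unfolding same_zero_def B_def by blast
      show "\<exists>r\<in>T \<union> (L1 \<union> r ` F0). \<forall>z\<in>{x, y}. \<forall>t. poly (Q z) t = 0 \<longrightarrow> sgn (poly (P z) t) = sgn (poly (r z) t)"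
        if Q: "Q \<in> F0" "Q x \<noteq> 0" for Q
      proof (intro bexI[of _ "r Q"] ballI allI impI)
        fix z t assume z: "z \<in> {x,y}" and t: "poly (Q z) t = 0"
        have zB: "z \<in> B" using z xy by auto
        have "Q z \<noteq> 0"
          using z H(3) same_signs_trans[OF same_signs_sym[of H x0 x], of y] xy Q unfolding B_def by blast
        then show "sgn (poly (P z) t) = sgn (poly (r Q z) t)"
          unfolding r_def using Bd[OF zB Q(1)] t by (intro reduct_sgn_at_root) auto
      qed (use Q in auto)
    qed (use F0 Pd xy D in \<open>auto simp: F0_def\<close>)
    then show "determined n {y\<in>A. same_signs H x0 y} (insert P F0)"
      unfolding determined_def B_def[symmetric] using H' by blast
  qed
  moreover have "insert P T \<union> L \<subseteq> insert P F0" using L1(2) by (auto simp: F0_def)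
  ultimately show ?case by (rule determined_mono)
qed

lemma determined_degree_less:
  assumes "finite F" "\<And>P. P \<in> F \<Longrightarrow> fam n P" "\<And>P x. P \<in> F \<Longrightarrow> x \<in> A \<Longrightarrow> degree (P x) < D"
  shows "determined n A F"
  using assms
proof (induction D arbitrary: A F)
  case 0
  then have "A = {} \<or> F = {}" by force
  then show ?case unfolding determined_def by (intro exI[of _ "{}"]) (auto simp: patterns_subset_def agree_def)
next
  case (Suc D)
  show ?case
  proof (cases "D = 0")
    case True
    show ?thesis unfolding determined_def
    proof (intro exI[of _ "(\<lambda>P x. coeff (P x) 0) ` F"] conjI ballI impI)
      show "finite ((\<lambda>P x. coeff (P x) 0) ` F)" using Suc.prems by auto
      show "(\<lambda>P x. coeff (P x) 0) ` F \<subseteq> pol n" using Suc.prems by (auto simp: fam_def)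
      fix x y assume xy: "x \<in> A" "y \<in> A" "same_signs ((\<lambda>P x. coeff (P x) 0) ` F) x y"
      have "poly (P z) t = coeff (P z) 0" if "P \<in> F" "z \<in> A" for P z t
        using Suc.prems(3)[OF that] True by (auto simp: poly_altdef)
      then show "patterns_subset F x y" using xy by (auto simp: patterns_subset_def agree_def same_signs_def)
    qed
  next
    case False
    have "\<forall>P\<in>F. fam n P" using Suc.prems(2) by blast
    from coeffs_of_families[OF Suc.prems(1) this] obtain H where H: "finite H" "H \<subseteq> pol n"
      "\<forall>x y. same_signs H x y \<longrightarrow> (\<forall>Q\<in>F. degree (Q x) = degree (Q y) \<and> (Q x = 0 \<longleftrightarrow> Q y = 0))"
      by (elim exE conjE) (rule that)
    show ?thesis
    proof (rule determined_split[OF H(1,2)])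
      fix x0 assume x0: "x0 \<in> A"
      let ?T = "{P\<in>F. degree (P x0) = D}" and ?L = "{P\<in>F. degree (P x0) < D}"
      have F: "F = ?T \<union> ?L" using Suc.prems(3)[OF _ x0] by (auto simp: less_Suc_eq)
      have "determined n {y\<in>A. same_signs H x0 y} (?T \<union> ?L)"
        by (rule determined_step[OF Suc.IH]) (use False Suc.prems H(3) in auto)
      then show "determined n {y\<in>A. same_signs H x0 y} F" using F by simp
    qed
  qed
qed

theorem sign_patterns_determined:
  assumes "finite F" "\<And>P. P \<in> F \<Longrightarrow> fam n P"
  shows "\<exists>H. finite H \<and> H \<subseteq> pol n \<and> (\<forall>x y. same_signs H x y \<longrightarrow> patterns_subset F x y)"
proof -
  from assms(2) obtain D where D: "\<And>P x. P \<in> F \<Longrightarrow> degree (P x) \<le> D P" unfolding fam_def by metis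
  have "determined n UNIV F"
  proof (rule determined_degree_less[OF assms])
    fix P x assume "P \<in> F"
    then show "degree (P x) < Suc (Max (D ` F))"
      using D[of P x] assms(1) by (meson Max_ge finite_imageI imageI le_imp_less_Suc order_trans)
  qed auto
  then show ?thesis by (auto simp: determined_def)
qed

section \<open>Semialgebraic sets and elimination of a variable\<close>

text \<open>Semialgebraic sets in the variables below \<open>n\<close>, as cylinders in the space of sequences.
  Defining them as unions of sign classes makes closure under Boolean operations immediate.\<close>

definition sa :: "nat \<Rightarrow> env set \<Rightarrow> bool" where
  "sa n S \<longleftrightarrow> (\<exists>H. finite H \<and> H \<subseteq> pol n \<and> (\<forall>x y. same_signs H x y \<longrightarrow> (x \<in> S \<longleftrightarrow> y \<in> S)))"

lemma saI:
  assumes "finite H" "H \<subseteq> pol n" "\<And>x y. same_signs H x y \<Longrightarrow> x \<in> S \<Longrightarrow> y \<in> S"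
  shows "sa n S"
  unfolding sa_def
proof (intro exI[of _ H] conjI allI impI)
  show "x \<in> S \<longleftrightarrow> y \<in> S" if "same_signs H x y" for x y
    using assms(3)[OF that] assms(3)[OF same_signs_sym[OF that]] by blast
qed (use assms in auto)

lemma sa_UNIV: "sa n UNIV"
  by (rule saI[of "{}"]) auto

lemma sa_empty: "sa n {}"
  by (rule saI[of "{}"]) auto

lemma sa_Compl: "sa n S \<Longrightarrow> sa n (- S)"
  unfolding sa_def by auto

lemma sa_Un: assumes "sa n S" "sa n T" shows "sa n (S \<union> T)"
proof -
  obtain H where H: "finite H" "H \<subseteq> pol n" "\<forall>x y. same_signs H x y \<longrightarrow> (x \<in> S \<longleftrightarrow> y \<in> S)"
    using assms(1) unfolding sa_def by blast
  obtain H' where H': "finite H'" "H' \<subseteq> pol n" "\<forall>x y. same_signs H' x y \<longrightarrow> (x \<in> T \<longleftrightarrow> y \<in> T)"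
    using assms(2) unfolding sa_def by blast
  show ?thesis using H H' by (intro saI[of "H \<union> H'"]) (auto simp: same_signs_Un)
qed

lemma sa_Int: "sa n S \<Longrightarrow> sa n T \<Longrightarrow> sa n (S \<inter> T)"
  using sa_Compl[OF sa_Un[OF sa_Compl sa_Compl]] by simp

lemma sa_Union: "finite \<F> \<Longrightarrow> (\<And>S. S \<in> \<F> \<Longrightarrow> sa n S) \<Longrightarrow> sa n (\<Union>\<F>)"
  by (induction \<F> rule: finite_induct) (auto intro: sa_empty sa_Un)

lemma sa_INT: "finite I \<Longrightarrow> (\<And>i. i \<in> I \<Longrightarrow> sa n (S i)) \<Longrightarrow> sa n (\<Inter>i\<in>I. S i)"
  by (induction I rule: finite_induct) (auto intro: sa_UNIV sa_Int)

lemma sa_mono: "sa n S \<Longrightarrow> n \<le> m \<Longrightarrow> sa m S"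
  unfolding sa_def by (meson pol_mono subset_iff)

lemma sa_cong:
  assumes "sa n S" "\<And>i. i < n \<Longrightarrow> x i = y i"
  shows "x \<in> S \<longleftrightarrow> y \<in> S"
proof -
  obtain H where H: "H \<subseteq> pol n" "\<forall>x y. same_signs H x y \<longrightarrow> (x \<in> S \<longleftrightarrow> y \<in> S)"
    using assms(1) unfolding sa_def by blast
  have "sgn (h x) = sgn (h y)" if "h \<in> H" for h using pol_cong[of h n x y] that H(1) assms(2) by auto
  then have "same_signs H x y" unfolding same_signs_def by blast
  then show ?thesis using H(2) by blast
qed

lemma sa_pos: "p \<in> pol n \<Longrightarrow> sa n {x. p x > 0}"
  by (rule saI[of "{p}"]) (auto simp: same_signs_def sgn_if split: if_splits)

lemma sa_neg: "p \<in> pol n \<Longrightarrow> sa n {x. p x < 0}"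
  by (rule saI[of "{p}"]) (auto simp: same_signs_def sgn_if split: if_splits)

lemma sa_nonneg: "p \<in> pol n \<Longrightarrow> sa n {x. p x \<ge> 0}"
  by (rule saI[of "{p}"]) (auto simp: same_signs_def sgn_if split: if_splits)

lemma sa_zero: "p \<in> pol n \<Longrightarrow> sa n {x. p x = 0}"
  by (rule saI[of "{p}"]) (auto simp: same_signs_def sgn_if split: if_splits)

lemma sa_sign_class: "finite H \<Longrightarrow> H \<subseteq> pol n \<Longrightarrow> sa n {y. same_signs H z y}"
  by (rule saI[of H]) (auto intro: same_signs_trans)

definition at_last_var :: "nat \<Rightarrow> env pfam set \<Rightarrow> (env \<Rightarrow> real) set" where
  "at_last_var n F = (\<lambda>P x. poly (P x) (x n)) ` F"

lemma same_signs_at_last_var: "same_signs (at_last_var n F) x y \<longleftrightarrow> agree F x (x n) y (y n)"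
  by (simp add: same_signs_def at_last_var_def agree_def)

lemma at_last_var_pol: "\<forall>P\<in>F. fam n P \<Longrightarrow> at_last_var n F \<subseteq> pol (Suc n)"
  unfolding at_last_var_def by (auto intro!: fam_imp_pol pol.var)

lemma agree_upd:
  assumes "\<forall>P\<in>F. fam n P"
  shows "agree F (x(n := a)) t y u \<longleftrightarrow> agree F x t y u" "agree F x t (y(n := a)) u \<longleftrightarrow> agree F x t y u"
proof -
  have "P (z(n := a)) = P z" if "P \<in> F" for P z
    using fam_cong[of n P "z(n := a)" z] assms that by simp
  then show "agree F (x(n := a)) t y u \<longleftrightarrow> agree F x t y u" "agree F x t (y(n := a)) u \<longleftrightarrow> agree F x t y u"
    unfolding agree_def by metis+
qed

text \<open>The form in which the analysis of families is used: \<open>F\<close> describes the set in the direction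
  of the last variable, and over each sign class of \<open>H\<close> the same patterns of \<open>F\<close> occur.\<close>

lemma cylindrical:
  assumes "sa (Suc n) S"
  shows "\<exists>F H. finite F \<and> pder_closed F \<and> (\<forall>P\<in>F. fam n P) \<and> finite H \<and> H \<subseteq> pol n \<and>
    (\<forall>x y. agree F x (x n) y (y n) \<longrightarrow> (x \<in> S \<longleftrightarrow> y \<in> S)) \<and>
    (\<forall>x y. same_signs H x y \<longrightarrow> patterns_subset F x y \<and> same_zero F x y)"
proof -
  obtain G where G: "finite G" "G \<subseteq> pol (Suc n)" "\<forall>x y. same_signs G x y \<longrightarrow> (x \<in> S \<longleftrightarrow> y \<in> S)"
    using assms unfolding sa_def by blast
  have "\<forall>p\<in>G. \<exists>P. fam n P \<and> (\<forall>x. p x = poly (P x) (x n))" using G(2) pol_Suc_imp_fam by blast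
  then obtain P where P: "\<And>p. p \<in> G \<Longrightarrow> fam n (P p)" "\<And>p x. p \<in> G \<Longrightarrow> p x = poly (P p x) (x n)" by metis
  have "finite (P ` G)" "\<forall>Q\<in>P ` G. fam n Q" using G(1) P(1) by auto
  from pder_closure[OF this] obtain F where F: "finite F" "P ` G \<subseteq> F" "pder_closed F" "\<forall>Q\<in>F. fam n Q"
    by (elim exE conjE) (rule that)
  from coeffs_of_families[OF F(1,4)] obtain H1 where H1: "finite H1" "H1 \<subseteq> pol n"
      "\<forall>x y. same_signs H1 x y \<longrightarrow> (\<forall>Q\<in>F. degree (Q x) = degree (Q y) \<and> (Q x = 0 \<longleftrightarrow> Q y = 0))"
    by (elim exE conjE) (rule that)
  from sign_patterns_determined[OF F(1), of n] F(4) obtain H2 where H2: "finite H2" "H2 \<subseteq> pol n"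
      "\<forall>x y. same_signs H2 x y \<longrightarrow> patterns_subset F x y"
    by blast
  have "x \<in> S \<longleftrightarrow> y \<in> S" if a: "agree F x (x n) y (y n)" for x y
  proof -
    have "sgn (p x) = sgn (p y)" if "p \<in> G" for p
      using agreeD[OF a, of "P p"] F(2) P(2)[OF that] that by auto
    then show ?thesis using G(3) by (simp add: same_signs_def)
  qed
  moreover have "patterns_subset F x y \<and> same_zero F x y" if "same_signs (H1 \<union> H2) x y" for x y
    using that H1(3) H2(3) by (auto simp: same_signs_Un same_zero_def)
  ultimately show ?thesis using F H1 H2
    by (intro exI[of _ F] exI[of _ "H1 \<union> H2"] conjI allI impI) auto
qed

text \<open>The Tarski--Seidenberg theorem: whether a set has a point over \<open>x\<close> depends only on the
  patterns that occur over \<open>x\<close>.\<close>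

theorem sa_projection:
  assumes "sa (Suc n) S"
  shows "sa n {x. \<exists>t. x(n := t) \<in> S}"
proof -
  from cylindrical[OF assms] obtain F H where F: "\<forall>P\<in>F. fam n P" "finite H" "H \<subseteq> pol n"
    "\<forall>x y. agree F x (x n) y (y n) \<longrightarrow> (x \<in> S \<longleftrightarrow> y \<in> S)" "\<forall>x y. same_signs H x y \<longrightarrow> patterns_subset F x y \<and> same_zero F x y"
    by (elim exE conjE) (rule that)
  show ?thesis
  proof (rule saI[OF F(2,3)])
    fix x y assume s: "same_signs H x y" and x: "x \<in> {x. \<exists>t. x(n := t) \<in> S}"
    then obtain t where t: "x(n := t) \<in> S" by blast
    have "patterns_subset F x y" using F(5) s by blast
    then obtain u where "agree F x t y u" by (auto simp: patterns_subset_def)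
    then have "agree F (x(n := t)) ((x(n := t)) n) (y(n := u)) ((y(n := u)) n)"
      using agree_upd[OF F(1)] by simp
    then have "y(n := u) \<in> S" using F(4) t by blast
    then show "y \<in> {x. \<exists>t. x(n := t) \<in> S}" by blast
  qed
qed

section \<open>Continuous sections\<close>

lemma agree_convex:
  assumes "pder_closed F" "agree F x s z v" "agree F x t z v" "s \<le> u" "u \<le> t"
  shows "agree F x u z v"
  unfolding agree_def
proof
  fix P assume P: "P \<in> F"
  have "thom_eq (P x) s t"
    by (rule agree_imp_thom_eq[OF assms(1) P agree_trans[OF assms(2) agree_sym[OF assms(3)]]])
  then show "sgn (poly (P x) u) = sgn (poly (P z) v)"
    using thom_interval[OF _ assms(4,5)] agreeD[OF assms(2) P] by simp
qed

lemma eventually_sgn_eq: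
  fixes h :: "env \<Rightarrow> real"
  assumes "continuous_on UNIV h" "h x \<noteq> 0"
  shows "\<forall>\<^sub>F y in at x within A. sgn (h y) = sgn (h x)"
proof -
  have t: "(h \<longlongrightarrow> h x) (at x within A)"
    using assms(1) by (meson UNIV_I continuous_on_def tendsto_within_subset subset_UNIV)
  show ?thesis
  proof (cases "h x > 0")
    case True
    then show ?thesis using order_tendstoD(1)[OF t True] by (auto elim!: eventually_mono)
  next
    case False
    with assms(2) have "h x < 0" by simp
    from order_tendstoD(2)[OF t this] show ?thesis using \<open>h x < 0\<close> by (auto elim!: eventually_mono)
  qed
qed

text \<open>Continuity of roots. Among the members of \<open>F\<close> vanishing at the root \<open>\<xi>\<close> over \<open>z\<close> take \<open>Q\<close> of
  least degree: then none of its nonzero derivatives vanishes at \<open>\<xi>\<close>. So the root is simple and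
  persists over nearby \<open>x\<close> as some root \<open>t\<close>, and all derivatives of \<open>Q\<close> keep their signs. The
  pattern of \<open>F\<close> at \<open>t\<close> occurs over \<open>z\<close> as well, at a point with the same signs of \<open>Q\<close> and its
  derivatives as \<open>\<xi>\<close>; by Thom's lemma that point is \<open>\<xi>\<close>. Hence \<open>t\<close> has the full pattern of \<open>\<xi>\<close>.\<close>

lemma root_isolated:
  assumes F: "finite F" "pder_closed F" "\<forall>P\<in>F. fam n P"
    and A: "\<And>x. x \<in> A \<Longrightarrow> patterns_subset F x z" "\<And>x. x \<in> A \<Longrightarrow> same_zero F x z"
    and r: "\<xi> \<in> roots_at F z" and eps: "\<epsilon> > 0"
  shows "\<forall>\<^sub>F x in at z within A. \<exists>t. \<bar>t - \<xi>\<bar> < \<epsilon> \<and> agree F x t z \<xi>"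
proof -
  define Good where "Good Q \<longleftrightarrow> Q \<in> F \<and> Q z \<noteq> 0 \<and> poly (Q z) \<xi> = 0" for Q
  have "\<exists>Q. Good Q" using r by (auto simp: roots_at_def Good_def)
  then obtain Q where Q: "Good Q" and Qmin: "\<And>R. Good R \<Longrightarrow> degree (Q z) \<le> degree (R z)"
    using ex_has_least_nat[of Good _ "\<lambda>Q. degree (Q z)"] by blast
  have QF: "Q \<in> F" "Q z \<noteq> 0" "poly (Q z) \<xi> = 0" using Q by (auto simp: Good_def)
  have Qdeg: "degree (Q z) > 0" using QF(2,3) by (metis degree_eq_zeroE gr0I poly_pCons mult_zero_right poly_0 add.right_neutral pCons_0_0)
  define d where "d k = (\<lambda>x. (pderiv ^^ k) (Q x))" for k
  have dF: "d k \<in> F" for k unfolding d_def by (rule pder_closed_iterate[OF F(2) QF(1)])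
  define F1 where "F1 = (\<lambda>k. d (Suc k)) ` UNIV"
  have F1: "F1 \<subseteq> F" using dF by (auto simp: F1_def)
  then have finF1: "finite F1" using F(1) finite_subset by blast
  have dk: "poly (d (Suc k) z) \<xi> \<noteq> 0" if "d (Suc k) z \<noteq> 0" for k
  proof
    assume "poly (d (Suc k) z) \<xi> = 0"
    then have "degree (Q z) \<le> degree (d (Suc k) z)" using that dF by (intro Qmin) (auto simp: Good_def)
    moreover have "degree (d (Suc k) z) \<le> degree (pderiv (Q z))"
      unfolding d_def funpow_Suc_right o_def by (rule degree_pderiv_iterate_le)
    ultimately show False using Qdeg by (simp add: degree_pderiv)
  qed
  then have xiF1: "\<xi> \<notin> roots_at F1 z" by (auto simp: F1_def roots_at_def)
  obtain e0 where e0: "e0 > 0" "\<forall>a\<in>roots_at F1 z. a \<noteq> \<xi> \<longrightarrow> e0 \<le> dist \<xi> a"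
    using finite_set_avoid[OF finite_roots_at[OF finF1]] by blast
  define e where "e = min (e0 / 2) (\<epsilon> / 2)"
  have e: "e > 0" "e < e0" "e < \<epsilon>" using e0(1) eps by (auto simp: e_def)
  define a b where "a = \<xi> - e" and "b = \<xi> + e"
  have ab: "a < \<xi>" "\<xi> < b" using e by (auto simp: a_def b_def)
  have near: "agree F1 z c z \<xi>" if "a \<le> c" "c \<le> b" for c
  proof (rule agree_if_no_root_between[OF _ _ xiF1])
    have far: "\<bar>\<xi> - w\<bar> > e" if "w \<in> roots_at F1 z" for w
      using e0(2) that xiF1 e(2) by (force simp: dist_real_def)
    show "w < c \<longleftrightarrow> w < \<xi>" if "w \<in> roots_at F1 z" for w
      using far[OF that] \<open>a \<le> c\<close> \<open>c \<le> b\<close> unfolding a_def b_def by linarith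
    show "c \<notin> roots_at F1 z"
      using far[of c] \<open>a \<le> c\<close> \<open>c \<le> b\<close> unfolding a_def b_def by linarith
  qed
  define \<sigma> where "\<sigma> = sgn (poly (pderiv (Q z)) \<xi>)"
  have d1F1: "d (Suc 0) \<in> F1" by (auto simp: F1_def)
  have d1: "sgn (poly (pderiv (Q z)) c) = \<sigma>" if "a \<le> c" "c \<le> b" for c
    using agreeD[OF near[OF that] d1F1] by (simp add: d_def \<sigma>_def)
  have "pderiv (Q z) \<noteq> 0" using Qdeg by (simp add: pderiv_eq_0_iff)
  then have "\<sigma> \<noteq> 0" using dk[of 0] by (simp add: \<sigma>_def d_def sgn_0_0)
  have Qa: "sgn (poly (Q z) a) = - \<sigma>"
  proof -
    obtain v where v: "a < v" "v < \<xi>" "poly (Q z) \<xi> - poly (Q z) a = (\<xi> - a) * poly (pderiv (Q z)) v"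
      using poly_MVT[OF ab(1)] by blast
    then have "poly (Q z) a = - ((\<xi> - a) * poly (pderiv (Q z)) v)" using QF(3) by simp
    then show ?thesis using d1[of v] v ab by (simp add: sgn_mult sgn_minus)
  qed
  have Qb: "sgn (poly (Q z) b) = \<sigma>"
  proof -
    obtain v where v: "\<xi> < v" "v < b" "poly (Q z) b - poly (Q z) \<xi> = (b - \<xi>) * poly (pderiv (Q z)) v"
      using poly_MVT[OF ab(2)] by blast
    then have "poly (Q z) b = (b - \<xi>) * poly (pderiv (Q z)) v" using QF(3) by simp
    then show ?thesis using d1[of v] v ab by (simp add: sgn_mult)
  qed
  have ev: "\<forall>\<^sub>F x in at z within A. sgn (poly (R x) c) = sgn (poly (R z) c)"
    if R: "R \<in> insert Q F1" and c: "c \<in> {a, b}" for R c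
  proof (cases "R z = 0")
    case True
    have "R x = 0" if "x \<in> A" for x
      using A(2)[OF that] R True QF(1) F1 by (auto simp: same_zero_def)
    then show ?thesis using True by (auto simp: eventually_at_filter)
  next
    case False
    have "poly (R z) c \<noteq> 0"
    proof (cases "R = Q")
      case True then show ?thesis using Qa Qb c \<open>\<sigma> \<noteq> 0\<close> by auto
    next
      case neq: False
      then have RF: "R \<in> F1" using R by auto
      then have "sgn (poly (R z) c) = sgn (poly (R z) \<xi>)" using agreeD[OF near, of c R] c ab by auto
      moreover have "poly (R z) \<xi> \<noteq> 0" using RF False xiF1 by (auto simp: roots_at_def)
      ultimately show ?thesis by (metis sgn_0_0)
    qed
    moreover have "fam n R" using R QF(1) F1 F(3) by blast
    ultimately show ?thesis
      by (intro eventually_sgn_eq pol_continuous[OF fam_imp_pol[OF _ pol.const]]) auto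
  qed
  have "\<forall>\<^sub>F x in at z within A. \<forall>R\<in>insert Q F1. \<forall>c\<in>{a,b}. sgn (poly (R x) c) = sgn (poly (R z) c)"
    using ev finF1 by (intro eventually_ball_finite ballI) auto
  moreover have "\<forall>\<^sub>F x in at z within A. x \<in> A" by (simp add: eventually_at_filter)
  ultimately show ?thesis
  proof eventually_elim
    case (elim x)
    have xa: "sgn (poly (Q x) a) = - \<sigma>" and xb: "sgn (poly (Q x) b) = \<sigma>" using elim(1) Qa Qb by auto
    have "poly (Q x) a * poly (Q x) b < 0"
      using xa xb \<open>\<sigma> \<noteq> 0\<close> unfolding \<sigma>_def by (auto simp: sgn_if mult_less_0_iff split: if_splits)
    then obtain t where t: "a < t" "t < b" "poly (Q x) t = 0" using poly_IVT[of a b "Q x"] ab by auto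
    have dx: "sgn (poly (d (Suc k) x) c) = sgn (poly (d (Suc k) z) \<xi>)" if "c \<in> {a,b}" for k c
    proof -
      have m: "d (Suc k) \<in> F1" by (auto simp: F1_def)
      have "sgn (poly (d (Suc k) x) c) = sgn (poly (d (Suc k) z) c)" using elim(1) m that by blast
      also have "\<dots> = sgn (poly (d (Suc k) z) \<xi>)" using agreeD[OF near m, of c] that ab by auto
      finally show ?thesis .
    qed
    have dxt: "sgn (poly (d k x) t) = sgn (poly (d k z) \<xi>)" for k
    proof (cases k)
      case 0
      then show ?thesis using t(3) QF(3) by (simp add: d_def)
    next
      case (Suc j)
      \<comment> \<open>Signs at the two ends of the interval suffice, by Thom's lemma.\<close>
      have "thom_eq (d k x) a b"
        unfolding thom_eq_def
      proof
        fix i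
        have "(pderiv ^^ i) (d k x) = d (Suc (i + j)) x" by (simp only: d_def Suc add_Suc_right[symmetric] funpow_add o_apply)
        then show "sgn (poly ((pderiv ^^ i) (d k x)) a) = sgn (poly ((pderiv ^^ i) (d k x)) b)"
          using dx[of a "i + j"] dx[of b "i + j"] by simp
      qed
      from thom_interval[OF this, of t] t have "sgn (poly (d k x) t) = sgn (poly (d k x) a)" by simp
      then show ?thesis using dx[of a j] Suc by simp
    qed
    obtain t' where t': "agree F x t z t'" using A(1)[OF elim(2)] by (auto simp: patterns_subset_def)
    have "thom_eq (Q z) \<xi> t'" unfolding thom_eq_def
    proof
      fix k
      show "sgn (poly ((pderiv ^^ k) (Q z)) \<xi>) = sgn (poly ((pderiv ^^ k) (Q z)) t')"
        using dxt[of k] agreeD[OF t' dF[of k]] by (simp add: d_def)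
    qed
    then have "t' = \<xi>" using thom_root_unique QF by blast
    then show ?case using t t' e(3) by (intro exI[of _ t]) (auto simp: a_def b_def)
  qed
qed

lemma continuous_section_root:
  assumes F: "finite F" "pder_closed F" "\<forall>P\<in>F. fam n P"
    and A: "\<And>x y. x \<in> A \<Longrightarrow> y \<in> A \<Longrightarrow> patterns_subset F x y" "\<And>x y. x \<in> A \<Longrightarrow> y \<in> A \<Longrightarrow> same_zero F x y"
    and z: "z \<in> A" and r: "\<tau> \<in> roots_at F z"
  shows "\<exists>s. continuous_on A s \<and> (\<forall>x\<in>A. agree F x (s x) z \<tau>)"
proof -
  have "\<forall>x\<in>A. \<exists>t. agree F x t z \<tau>"
    using A(1)[OF z] agree_sym unfolding patterns_subset_def by meson
  then obtain s where s: "\<And>x. x \<in> A \<Longrightarrow> agree F x (s x) z \<tau>" by metis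
  have sr: "s x \<in> roots_at F x" if "x \<in> A" for x
    using agree_roots_at[OF A(2)[OF that z] s[OF that]] r by simp
  have "continuous_on A s"
    unfolding continuous_on
  proof (intro ballI tendstoI)
    fix y and \<epsilon> :: real assume y: "y \<in> A" and eps: "\<epsilon> > 0"
    have "\<forall>\<^sub>F x in at y within A. \<exists>t. \<bar>t - s y\<bar> < \<epsilon> \<and> agree F x t y (s y)"
      by (rule root_isolated[OF F _ _ sr[OF y] eps]) (use A y in auto)
    moreover have "\<forall>\<^sub>F x in at y within A. x \<in> A" by (simp add: eventually_at_filter)
    ultimately show "\<forall>\<^sub>F x in at y within A. dist (s x) (s y) < \<epsilon>"
    proof eventually_elim
      case (elim x)
      then obtain t where t: "\<bar>t - s y\<bar> < \<epsilon>" "agree F x t y (s y)" by blast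
      have "agree F x (s x) x t"
        using agree_trans[OF s[OF elim(2)] agree_sym[OF agree_trans[OF t(2) s[OF y]]]] .
      then have "s x = t" by (rule roots_at_unique[OF F(2) sr[OF elim(2)]])
      then show ?case using t(1) by (simp add: dist_real_def)
    qed
  qed
  with s show ?thesis by blast
qed

text \<open>Roots keep their position relative to other points when patterns are transferred.\<close>

lemma root_order:
  assumes "pder_closed F" "same_zero F x z" "agree F x c z c0" "agree F x d z d0" "c \<in> roots_at F x"
  shows "c < d \<longleftrightarrow> c0 < d0" "d < c \<longleftrightarrow> d0 < c0" "c0 = d0 \<Longrightarrow> c = d"
proof -
  have *: "c = d" if "agree F x c x d" using roots_at_unique[OF assms(1,5) that] .
  show eq: "c = d" if "c0 = d0" using *[OF agree_trans[OF assms(3) agree_sym]] assms(4) that by simp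
  have c0: "c0 \<in> roots_at F z" using agree_roots_at[OF assms(2,3)] assms(5) by simp
  have eq': "c0 = d0" if "c = d"
    using roots_at_unique[OF assms(1) c0 agree_trans[OF agree_sym[OF assms(3)]]] assms(4) that by simp
  show "c < d \<longleftrightarrow> c0 < d0"
  proof (cases "c = d")
    case False then show ?thesis using thom_order_iff[OF assms(1) _ assms(3,4)] * by auto
  qed (use eq' in simp)
  show "d < c \<longleftrightarrow> d0 < c0"
  proof (cases "c = d")
    case False then show ?thesis using thom_order_iff[OF assms(1) _ assms(4,3)] *[OF agree_sym] by auto
  qed (use eq' in simp)
qed

text \<open>If the pattern at \<open>\<tau>\<close> is that of a root, the root itself is a section. Otherwise \<open>\<tau>\<close> lies in
  a gap, whose ends are sections of root patterns; the midpoint, or a point at distance one from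
  the only end, stays in the gap.\<close>

theorem continuous_section:
  assumes F: "finite F" "pder_closed F" "\<forall>P\<in>F. fam n P"
    and A: "\<And>x y. x \<in> A \<Longrightarrow> y \<in> A \<Longrightarrow> patterns_subset F x y" "\<And>x y. x \<in> A \<Longrightarrow> y \<in> A \<Longrightarrow> same_zero F x y"
    and z: "z \<in> A"
  shows "\<exists>s. continuous_on A s \<and> (\<forall>x\<in>A. agree F x (s x) z \<tau>)"
proof (cases "\<tau> \<in> roots_at F z")
  case True
  show ?thesis by (rule continuous_section_root[OF F A z True])
next
  case False
  let ?R = "roots_at F z"
  have fin: "finite ?R" by (rule finite_roots_at[OF F(1)])
  have sec: "\<exists>s. continuous_on A s \<and> (\<forall>x\<in>A. agree F x (s x) z c)" if "c \<in> ?R" for c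
    by (rule continuous_section_root[OF F A z that])
  \<comment> \<open>Lower and upper end of the gap; an end that does not exist leaves the value of \<open>Max\<close> or \<open>Min\<close> unspecified, so each use is guarded.\<close>
  define lo where "lo \<alpha> \<longleftrightarrow> continuous_on A \<alpha> \<and> (\<forall>x\<in>A. \<alpha> x \<in> roots_at F x \<and> agree F x (\<alpha> x) z (Max (?R \<inter> {..<\<tau>})))" for \<alpha>
  define hi where "hi \<beta> \<longleftrightarrow> continuous_on A \<beta> \<and> (\<forall>x\<in>A. \<beta> x \<in> roots_at F x \<and> agree F x (\<beta> x) z (Min (?R \<inter> {\<tau><..})))" for \<beta>
  have lo: "\<exists>\<alpha>. lo \<alpha>" if "?R \<inter> {..<\<tau>} \<noteq> {}"
  proof -
    have m: "Max (?R \<inter> {..<\<tau>}) \<in> ?R" using Max_in[OF _ that] fin by auto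
    from sec[OF m] show ?thesis unfolding lo_def using agree_roots_at[OF A(2)[OF _ z]] m by blast
  qed
  have hi: "\<exists>\<beta>. hi \<beta>" if "?R \<inter> {\<tau><..} \<noteq> {}"
  proof -
    have m: "Min (?R \<inter> {\<tau><..}) \<in> ?R" using Min_in[OF _ that] fin by auto
    from sec[OF m] show ?thesis unfolding hi_def using agree_roots_at[OF A(2)[OF _ z]] m by blast
  qed
  have "\<exists>s. continuous_on A s \<and> (\<forall>\<alpha>. ?R \<inter> {..<\<tau>} \<noteq> {} \<longrightarrow> lo \<alpha> \<longrightarrow> (\<forall>x\<in>A. \<alpha> x < s x)) \<and>
        (\<forall>\<beta>. ?R \<inter> {\<tau><..} \<noteq> {} \<longrightarrow> hi \<beta> \<longrightarrow> (\<forall>x\<in>A. s x < \<beta> x))"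
  proof -
    have lo_unique: "\<alpha> x = \<alpha>' x" if "lo \<alpha>" "lo \<alpha>'" "x \<in> A" for \<alpha> \<alpha>' x
      using that root_order(3)[OF F(2) A(2)[OF that(3) z]] unfolding lo_def by blast
    have hi_unique: "\<beta> x = \<beta>' x" if "hi \<beta>" "hi \<beta>'" "x \<in> A" for \<beta> \<beta>' x
      using that root_order(3)[OF F(2) A(2)[OF that(3) z]] unfolding hi_def by blast
    consider "?R \<inter> {..<\<tau>} = {}" "?R \<inter> {\<tau><..} = {}" | "?R \<inter> {..<\<tau>} \<noteq> {}" "?R \<inter> {\<tau><..} = {}"
      | "?R \<inter> {..<\<tau>} = {}" "?R \<inter> {\<tau><..} \<noteq> {}" | "?R \<inter> {..<\<tau>} \<noteq> {}" "?R \<inter> {\<tau><..} \<noteq> {}" by blast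
    then show ?thesis
    proof cases
      case 1
      then show ?thesis by (intro exI[of _ "\<lambda>_. 0"]) (auto intro: continuous_on_const)
    next
      case 2
      then obtain \<alpha> where a: "lo \<alpha>" using lo by blast
      have "\<alpha>' x < \<alpha> x + 1" if "lo \<alpha>'" "x \<in> A" for \<alpha>' x using lo_unique[OF that(1) a that(2)] by simp
      moreover have "continuous_on A (\<lambda>x. \<alpha> x + 1)" using a by (auto simp: lo_def intro: continuous_intros)
      ultimately show ?thesis using 2 by (intro exI[of _ "\<lambda>x. \<alpha> x + 1"]) simp
    next
      case 3
      then obtain \<beta> where b: "hi \<beta>" using hi by blast
      have "\<beta> x - 1 < \<beta>' x" if "hi \<beta>'" "x \<in> A" for \<beta>' x using hi_unique[OF that(1) b that(2)] by simp
      moreover have "continuous_on A (\<lambda>x. \<beta> x - 1)" using b by (auto simp: hi_def intro: continuous_intros)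
      ultimately show ?thesis using 3 by (intro exI[of _ "\<lambda>x. \<beta> x - 1"]) simp
    next
      case 4
      then obtain \<alpha> \<beta> where a: "lo \<alpha>" and b: "hi \<beta>" using lo hi by blast
      have m: "Max (?R \<inter> {..<\<tau>}) < \<tau>" "\<tau> < Min (?R \<inter> {\<tau><..})"
        using Max_in[OF _ 4(1)] Min_in[OF _ 4(2)] fin by auto
      have lt: "\<alpha> x < \<beta> x" if "x \<in> A" for x
      proof -
        have "\<alpha> x < \<beta> x \<longleftrightarrow> Max (?R \<inter> {..<\<tau>}) < Min (?R \<inter> {\<tau><..})"
          using that a b by (intro root_order(1)[OF F(2) A(2)[OF that z]]) (auto simp: lo_def hi_def)
        then show ?thesis using m by simp
      qed
      have "\<alpha>' x < (\<alpha> x + \<beta> x) / 2" if "lo \<alpha>'" "x \<in> A" for \<alpha>' x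
        using lo_unique[OF that(1) a that(2)] lt[OF that(2)] by simp
      moreover have "(\<alpha> x + \<beta> x) / 2 < \<beta>' x" if "hi \<beta>'" "x \<in> A" for \<beta>' x
        using hi_unique[OF that(1) b that(2)] lt[OF that(2)] by simp
      moreover have "continuous_on A (\<lambda>x. (\<alpha> x + \<beta> x) / 2)"
        using a b by (auto simp: lo_def hi_def intro!: continuous_intros)
      ultimately show ?thesis by (intro exI[of _ "\<lambda>x. (\<alpha> x + \<beta> x) / 2"]) simp
    qed
  qed
  then obtain s where s: "continuous_on A s"
    "\<And>\<alpha> x. ?R \<inter> {..<\<tau>} \<noteq> {} \<Longrightarrow> lo \<alpha> \<Longrightarrow> x \<in> A \<Longrightarrow> \<alpha> x < s x"
    "\<And>\<beta> x. ?R \<inter> {\<tau><..} \<noteq> {} \<Longrightarrow> hi \<beta> \<Longrightarrow> x \<in> A \<Longrightarrow> s x < \<beta> x" by blast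
  have "agree F x (s x) z \<tau>" if x: "x \<in> A" for x
  proof -
    obtain u where u: "agree F x u z \<tau>"
      using A(1)[OF z x] agree_sym unfolding patterns_subset_def by meson
    have uR: "u \<notin> roots_at F x" using agree_roots_at[OF A(2)[OF x z] u] False by simp
    have side: "c < u \<and> c < s x \<or> u < c \<and> s x < c" if c: "c \<in> roots_at F x" for c
    proof -
      obtain c0 where c0: "agree F x c z c0" using A(1)[OF x z] unfolding patterns_subset_def by blast
      have c0R: "c0 \<in> ?R" using agree_roots_at[OF A(2)[OF x z] c0] c by simp
      note ord = root_order[OF F(2) A(2)[OF x z] c0 _ c]
      have "c0 \<noteq> \<tau>" using False c0R by auto
      then consider "c0 < \<tau>" | "\<tau> < c0" by linarith
      then show ?thesis
      proof cases
        case 1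
        then have ne: "?R \<inter> {..<\<tau>} \<noteq> {}" using c0R by auto
        obtain \<alpha> where a: "lo \<alpha>" using lo[OF ne] by blast
        have ax: "agree F x (\<alpha> x) z (Max (?R \<inter> {..<\<tau>}))" using a x by (auto simp: lo_def)
        have "c0 \<le> Max (?R \<inter> {..<\<tau>})" using c0R 1 fin by (intro Max_ge) auto
        then have "c \<le> \<alpha> x" using ord(1,3)[OF ax] by (metis le_less)
        then show ?thesis using ord(1)[OF u] 1 s(2)[OF ne a x] by auto
      next
        case 2
        then have ne: "?R \<inter> {\<tau><..} \<noteq> {}" using c0R by auto
        obtain \<beta> where b: "hi \<beta>" using hi[OF ne] by blast
        have bx: "agree F x (\<beta> x) z (Min (?R \<inter> {\<tau><..}))" using b x by (auto simp: hi_def)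
        have "Min (?R \<inter> {\<tau><..}) \<le> c0" using c0R 2 fin by (intro Min_le) auto
        then have "\<beta> x \<le> c" using ord(2,3)[OF bx] by (metis le_less)
        then show ?thesis using ord(2)[OF u] 2 s(3)[OF ne b x] by auto
      qed
    qed
    have "agree F x (s x) x u"
    proof (rule agree_if_no_root_between[OF _ _ uR])
      show "a < s x \<longleftrightarrow> a < u" if "a \<in> roots_at F x" for a using side[OF that] by auto
      show "s x \<notin> roots_at F x" using side by blast
    qed
    then show ?thesis using u by (rule agree_trans)
  qed
  with s(1) show ?thesis by blast
qed

section \<open>Path-connected pieces and curves\<close>

lemma continuous_on_upd:
  assumes "continuous_on A (g :: 'a::topological_space \<Rightarrow> env)" "continuous_on A s"
  shows "continuous_on A (\<lambda>x. (g x)(n := s x))"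
proof (rule continuous_on_coordinatewise_then_product)
  fix i
  show "continuous_on A (\<lambda>x. ((g x)(n := s x)) i)"
    using assms continuous_on_product_then_coordinatewise[OF assms(1)] by (cases "i = n") auto
qed

text \<open>Any point can be moved vertically, inside its convex fibre, to the graph of a section, which
  is a continuous image of the base.\<close>

lemma path_connected_cell:
  assumes F: "finite F" "pder_closed F" "\<forall>P\<in>F. fam n P"
    and D: "sa n D" "path_connected D"
    and A: "\<And>x y. x \<in> D \<Longrightarrow> y \<in> D \<Longrightarrow> patterns_subset F x y" "\<And>x y. x \<in> D \<Longrightarrow> y \<in> D \<Longrightarrow> same_zero F x y"
    and z: "z \<in> D"
  shows "path_connected {y\<in>D. agree F y (y n) z \<tau>}" (is "path_connected ?C")
proof -
  obtain s where s: "continuous_on D s" "\<And>x. x \<in> D \<Longrightarrow> agree F x (s x) z \<tau>"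
    using continuous_section[OF F A z] by blast
  have upd: "x(n := a) \<in> D \<longleftrightarrow> x \<in> D" for x a
    by (rule sa_cong[OF D(1)]) simp
  have updC: "x(n := a) \<in> ?C \<longleftrightarrow> x \<in> D \<and> agree F x a z \<tau>" for x a
    using upd agree_upd(1)[OF F(3)] by simp
  let ?g = "\<lambda>x. x(n := s x)"
  have "path_connected (?g ` D)"
    by (intro path_connected_continuous_image continuous_on_upd s(1) D(2) continuous_on_id)
  moreover have gD: "?g ` D \<subseteq> ?C" using s(2) updC by blast
  ultimately have horizontal: "path_component ?C (?g x) (?g y)" if "x \<in> D" "y \<in> D" for x y
    using that by (meson imageI path_component_of_subset path_connected_component)
  have vertical: "path_component ?C x (?g x)" if x: "x \<in> ?C" for x
  proof -
    have "path_connected ((\<lambda>t. x(n := t)) ` closed_segment (x n) (s x))"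
      by (intro path_connected_continuous_image continuous_on_upd continuous_on_const continuous_on_id
          convex_imp_path_connected convex_closed_segment)
    moreover have "(\<lambda>t. x(n := t)) ` closed_segment (x n) (s x) \<subseteq> ?C"
    proof (rule image_subsetI)
      fix t assume t: "t \<in> closed_segment (x n) (s x)"
      have a: "x \<in> D" "agree F x (x n) z \<tau>" "agree F x (s x) z \<tau>" using x s(2) by auto
      have "agree F x t z \<tau>"
        using t agree_convex[OF F(2) a(2,3)] agree_convex[OF F(2) a(3,2)]
        by (auto simp: closed_segment_eq_real_ivl split: if_splits)
      then show "x(n := t) \<in> ?C" using updC a(1) by blast
    qed
    ultimately have "path_component ?C (x(n := x n)) (x(n := s x))"
      by (meson ends_in_segment imageI path_component_of_subset path_connected_component)
    then show ?thesis by simp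
  qed
  show ?thesis
    unfolding path_connected_component
  proof (intro ballI)
    fix x y assume "x \<in> ?C" "y \<in> ?C"
    then show "path_component ?C x y"
      using vertical[of x] vertical[of y] horizontal[of x y]
      by (auto intro: path_component_trans path_component_sym)
  qed
qed

lemma path_connected_UNIV_env: "path_connected (UNIV :: env set)"
  unfolding path_connected_component
proof (intro ballI)
  fix x y :: env
  let ?g = "\<lambda>t::real. \<lambda>i. (1 - t) * x i + t * y i"
  have "path_connected (?g ` {0..1})"
    by (intro path_connected_continuous_image continuous_on_coordinatewise_then_product
        continuous_intros convex_imp_path_connected convex_real_interval)
  moreover have "x \<in> ?g ` {0..1}" by (rule image_eqI[of _ _ 0]) auto
  moreover have "y \<in> ?g ` {0..1}" by (rule image_eqI[of _ _ 1]) auto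
  ultimately have "path_component (?g ` {0..1}) x y" unfolding path_connected_component by blast
  then show "path_component UNIV x y" by (rule path_component_of_subset[OF subset_UNIV])
qed

text \<open>Induction on the number of variables: the pieces of the sign classes of \<open>H\<close> serve as bases,
  and over each of them every pattern gives a cell.\<close>

lemma sa_path_connected_pieces:
  "sa n S \<Longrightarrow> \<exists>\<C>. finite \<C> \<and> (\<forall>C\<in>\<C>. sa n C \<and> path_connected C) \<and> S = \<Union>\<C>"
proof (induction n arbitrary: S)
  case 0
  have "S = {} \<or> S = UNIV" using sa_cong[OF 0] by auto
  then show ?case
  proof
    assume "S = {}" then show ?thesis by (intro exI[of _ "{}"]) auto
  next
    assume "S = UNIV" then show ?thesis
      by (intro exI[of _ "{UNIV}"]) (auto intro: sa_UNIV path_connected_UNIV_env)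
  qed
next
  case (Suc n)
  from cylindrical[OF Suc.prems] obtain F H where F: "finite F" "pder_closed F" "\<forall>P\<in>F. fam n P" "finite H" "H \<subseteq> pol n"
    and S: "\<forall>x y. agree F x (x n) y (y n) \<longrightarrow> (x \<in> S \<longleftrightarrow> y \<in> S)"
    and H: "\<forall>x y. same_signs H x y \<longrightarrow> patterns_subset F x y \<and> same_zero F x y"
    by (elim exE conjE) (rule that)
  define cls where "cls z = {y\<in>UNIV. same_signs H z y}" for z
  have "\<forall>z. \<exists>\<D>. finite \<D> \<and> (\<forall>D\<in>\<D>. sa n D \<and> path_connected D) \<and> cls z = \<Union>\<D>"
    using Suc.IH sa_sign_class[OF F(4,5)] by (simp add: cls_def)
  then have "\<forall>A\<in>range cls. \<exists>\<D>. finite \<D> \<and> (\<forall>D\<in>\<D>. sa n D \<and> path_connected D) \<and> A = \<Union>\<D>" by blast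
  then obtain \<D> where \<D>: "\<And>A. A \<in> range cls \<Longrightarrow> finite (\<D> A)" "\<And>A D. A \<in> range cls \<Longrightarrow> D \<in> \<D> A \<Longrightarrow> sa n D \<and> path_connected D"
     "\<And>A. A \<in> range cls \<Longrightarrow> A = \<Union>(\<D> A)"
    by metis
  define cell where "cell D z = {y\<in>D. same_signs (at_last_var n F) z y}" for D z
  define \<C> where "\<C> = (\<Union>A\<in>range cls. \<Union>D\<in>\<D> A. cell D ` (S \<inter> D))"
  have fin: "finite (at_last_var n F)" unfolding at_last_var_def using F(1) by simp
  have "finite (range cls)" unfolding cls_def by (rule finite_sign_classes[OF F(4)])
  then have "finite \<C>" unfolding \<C>_def cell_def
    using \<D>(1) finite_sign_classes[OF fin] by (intro finite_UN_I) auto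
  moreover have "sa (Suc n) C \<and> path_connected C" if C: "C \<in> \<C>" for C
  proof -
    obtain w D z where w: "D \<in> \<D> (cls w)" "z \<in> S \<inter> D" "C = cell D z"
      using C unfolding \<C>_def by blast
    have D: "sa n D" "path_connected D" using \<D>(2)[OF rangeI w(1)] by blast+
    have "D \<subseteq> cls w" using Union_upper[OF w(1)] \<D>(3)[OF rangeI, of w] by simp
    then have "same_signs H x y" if "x \<in> D" "y \<in> D" for x y
      using that unfolding cls_def by (blast intro: same_signs_trans same_signs_sym)
    then have "path_connected {y\<in>D. agree F y (y n) z (z n)}"
      using w(2) H by (intro path_connected_cell[OF F(1-3) D]) blast+
    also have "{y\<in>D. agree F y (y n) z (z n)} = C"
      unfolding w(3) cell_def same_signs_at_last_var
      by (intro Collect_cong conj_cong refl iffI) (erule agree_sym)+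
    finally have "path_connected C" .
    moreover have "C = D \<inter> {y. same_signs (at_last_var n F) z y}" unfolding w(3) cell_def by blast
    then have "sa (Suc n) C"
      using sa_Int[OF sa_mono[OF D(1)] sa_sign_class[OF fin at_last_var_pol[OF F(3)]]] by simp
    ultimately show ?thesis by blast
  qed
  moreover have "S = \<Union>\<C>"
  proof
    show "S \<subseteq> \<Union>\<C>"
    proof
      fix y assume y: "y \<in> S"
      have "y \<in> cls y" by (simp add: cls_def same_signs_refl)
      then have "y \<in> \<Union>(\<D> (cls y))" using \<D>(3)[OF rangeI, of y] by simp
      then obtain D where "D \<in> \<D> (cls y)" "y \<in> D" by blast
      moreover have "y \<in> cell D y" using \<open>y \<in> D\<close> by (simp add: cell_def same_signs_refl)
      ultimately show "y \<in> \<Union>\<C>" using y unfolding \<C>_def by blast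
    qed
    show "\<Union>\<C> \<subseteq> S" using S unfolding \<C>_def cell_def same_signs_at_last_var by blast
  qed
  ultimately show ?case by blast
qed

lemma poly_sgn_constant_near_0:
  fixes p :: "real poly"
  shows "\<exists>\<epsilon>>0. \<forall>t u. 0 < t \<and> t < \<epsilon> \<and> 0 < u \<and> u < \<epsilon> \<longrightarrow> sgn (poly p t) = sgn (poly p u)"
proof (cases "p = 0")
  case True then show ?thesis by (intro exI[of _ 1]) auto
next
  case False
  obtain e where e: "e > 0" "\<forall>a\<in>{x. poly p x = 0}. a \<noteq> 0 \<longrightarrow> e \<le> dist 0 a"
    using finite_set_avoid[OF poly_roots_finite[OF False]] by blast
  have "poly p a \<noteq> 0" if "0 < a" "a < e" for a using e(2) that by (force simp: dist_real_def)
  then have "sgn (poly p t) = sgn (poly p u)" if "0 < t" "t < e" "0 < u" "u < e" for t u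
    using that by (intro poly_sgn_constant_if_no_root) (auto simp: min_def max_def split: if_splits)
  with e(1) show ?thesis by blast
qed

text \<open>A nonzero univariate polynomial has no roots immediately to the right of \<open>0\<close>.\<close>

lemma sa_1_near_0:
  assumes "sa 1 S"
  shows "\<exists>\<epsilon>>0. \<forall>x y. 0 < x 0 \<and> x 0 < \<epsilon> \<and> 0 < y 0 \<and> y 0 < \<epsilon> \<longrightarrow> (x \<in> S \<longleftrightarrow> y \<in> S)"
proof -
  obtain H where H: "finite H" "H \<subseteq> pol 1" "\<forall>x y. same_signs H x y \<longrightarrow> (x \<in> S \<longleftrightarrow> y \<in> S)"
    using assms unfolding sa_def by blast
  have "\<forall>h\<in>H. \<exists>\<epsilon>>0. \<forall>x y. 0 < x 0 \<and> x 0 < \<epsilon> \<and> 0 < y 0 \<and> y 0 < \<epsilon> \<longrightarrow> sgn (h x) = sgn (h y)"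
  proof
    fix h assume "h \<in> H"
    then have "h \<in> pol (Suc 0)" using H(2) by auto
    then obtain P where P: "fam 0 P" "\<forall>x. h x = poly (P x) (x 0)" using pol_Suc_imp_fam by blast
    have "P x = P undefined" for x by (rule fam_cong[OF P(1)]) simp
    then have "h x = poly (P undefined) (x 0)" for x using P(2) by metis
    then show "\<exists>\<epsilon>>0. \<forall>x y. 0 < x 0 \<and> x 0 < \<epsilon> \<and> 0 < y 0 \<and> y 0 < \<epsilon> \<longrightarrow> sgn (h x) = sgn (h y)"
      using poly_sgn_constant_near_0[of "P undefined"] by metis
  qed
  then obtain e where e: "\<And>h. h \<in> H \<Longrightarrow> e h > 0"
    "\<And>h x y. h \<in> H \<Longrightarrow> 0 < x 0 \<Longrightarrow> x 0 < e h \<Longrightarrow> 0 < y 0 \<Longrightarrow> y 0 < e h \<Longrightarrow> sgn (h x) = sgn (h y)"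
    by metis
  define \<epsilon> where "\<epsilon> = Min (insert 1 (e ` H))"
  have "\<epsilon> > 0" unfolding \<epsilon>_def using H(1) e(1) by (subst Min_gr_iff) auto
  moreover have le: "\<epsilon> \<le> e h" if "h \<in> H" for h unfolding \<epsilon>_def using H(1) that by (intro Min_le) auto
  have "same_signs H x y" if "0 < x 0" "x 0 < \<epsilon>" "0 < y 0" "y 0 < \<epsilon>" for x y
    unfolding same_signs_def using e(2) le that by (meson less_le_trans)
  ultimately show ?thesis using H(3) by blast
qed

text \<open>The variable \<open>x 0\<close> is the parameter of the curve. In the induction step one of the finitely
  many sign classes has points over parameters arbitrarily close to \<open>0\<close>; the curve found in its
  base is lifted by a section. Asking for points over all small parameters would not pass to
  a single class.\<close>

lemma sa_curve:
  assumes "sa (Suc n) S" "\<exists>\<^sub>F t in at_right 0. \<exists>x\<in>S. x 0 = t"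
  shows "\<exists>\<epsilon>>0. \<exists>\<gamma>. continuous_on {0<..<\<epsilon>} \<gamma> \<and> (\<forall>t\<in>{0<..<\<epsilon>}. \<gamma> t \<in> S \<and> \<gamma> t 0 = t)"
  using assms
proof (induction n arbitrary: S)
  case 0
  then obtain \<epsilon> where e: "\<epsilon> > 0" "\<And>x y. 0 < x 0 \<Longrightarrow> x 0 < \<epsilon> \<Longrightarrow> 0 < y 0 \<Longrightarrow> y 0 < \<epsilon> \<Longrightarrow> (x \<in> S \<longleftrightarrow> y \<in> S)"
    using sa_1_near_0[of S] by auto
  have "\<forall>\<^sub>F t in at_right 0. 0 < t \<and> t < \<epsilon>" using eventually_at_right_real[OF e(1)] by simp
  from frequently_ex[OF frequently_eventually_frequently[OF 0(2) this]]
  obtain t x where "0 < t" "t < \<epsilon>" "x \<in> S" "x 0 = t" by blast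
  then have "(\<lambda>_. u) \<in> S" if "0 < u" "u < \<epsilon>" for u using e(2)[of x "\<lambda>_. u"] that by auto
  moreover have "continuous_on {0<..<\<epsilon>} (\<lambda>t. (\<lambda>_::nat. t))"
    by (intro continuous_on_coordinatewise_then_product continuous_on_id)
  ultimately show ?case using e(1) by (intro exI[of _ \<epsilon>] conjI exI[of _ "\<lambda>t. (\<lambda>_. t)"]) auto
next
  case (Suc n)
  let ?m = "Suc n"
  from cylindrical[OF Suc.prems(1)] obtain F H where F: "finite F" "pder_closed F" "\<forall>P\<in>F. fam ?m P" "finite H" "H \<subseteq> pol ?m"
    and S: "\<forall>x y. agree F x (x ?m) y (y ?m) \<longrightarrow> (x \<in> S \<longleftrightarrow> y \<in> S)"
    and H: "\<forall>x y. same_signs H x y \<longrightarrow> patterns_subset F x y \<and> same_zero F x y"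
    by (elim exE conjE) (rule that)
  define cls where "cls z = {y\<in>UNIV. same_signs (H \<union> at_last_var ?m F) z y}" for z
  have "finite (cls ` S)" unfolding cls_def
    using F(1,4) by (intro finite_sign_classes) (simp add: at_last_var_def)
  moreover have "\<exists>\<^sub>F t in at_right 0. \<exists>C\<in>cls ` S. \<exists>x\<in>C. x 0 = t"
    using Suc.prems(2) by (rule frequently_elim1) (auto simp: cls_def intro!: bexI same_signs_refl)
  ultimately have "\<exists>C\<in>cls ` S. \<exists>\<^sub>F t in at_right 0. \<exists>x\<in>C. x 0 = t"
    by (rule frequently_bex_finite)
  then obtain z where z: "z \<in> S" "\<exists>\<^sub>F t in at_right 0. \<exists>x\<in>cls z. x 0 = t" by blast
  let ?A = "{y. same_signs H z y}"
  have "\<exists>\<^sub>F t in at_right 0. \<exists>x\<in>?A. x 0 = t"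
    using z(2) by (rule frequently_elim1) (auto simp: cls_def same_signs_Un)
  from Suc.IH[OF sa_sign_class[OF F(4,5)] this] obtain \<epsilon> \<gamma> where g: "\<epsilon> > 0" "continuous_on {0<..<\<epsilon>} \<gamma>"
    "\<And>t. t \<in> {0<..<\<epsilon>} \<Longrightarrow> \<gamma> t \<in> ?A \<and> \<gamma> t 0 = t" by blast
  have "same_signs H x y" if "x \<in> ?A" "y \<in> ?A" for x y
    using that by (blast intro: same_signs_trans same_signs_sym)
  then have "\<exists>s. continuous_on ?A s \<and> (\<forall>x\<in>?A. agree F x (s x) z (z ?m))"
    using H by (intro continuous_section[OF F(1-3)]) (auto simp: same_signs_refl)
  then obtain s where s: "continuous_on ?A s" "\<And>x. x \<in> ?A \<Longrightarrow> agree F x (s x) z (z ?m)" by blast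
  let ?\<delta> = "\<lambda>t. (\<gamma> t)(?m := s (\<gamma> t))"
  have "continuous_on {0<..<\<epsilon>} ?\<delta>"
    using g by (intro continuous_on_upd continuous_on_compose2[OF s(1)]) auto
  moreover have "?\<delta> t \<in> S \<and> ?\<delta> t 0 = t" if "t \<in> {0<..<\<epsilon>}" for t
  proof -
    have "agree F (\<gamma> t) (s (\<gamma> t)) z (z ?m)" using s(2) g(3)[OF that] by blast
    then have "agree F (?\<delta> t) (?\<delta> t ?m) z (z ?m)" using agree_upd(1)[OF F(3)] by simp
    then have "?\<delta> t \<in> S" using S z(1) by blast
    then show ?thesis using g(3)[OF that] by simp
  qed
  ultimately show ?case using g(1) by (intro exI[of _ \<epsilon>] conjI exI[of _ ?\<delta>]) blast+
qed

section \<open>Transfer to Euclidean space\<close>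

definition idx :: "'n::finite \<Rightarrow> nat" where
  "idx = (SOME e. bij_betw e UNIV {..<CARD('n)})"

lemma bij_idx: "bij_betw (idx :: 'n::finite \<Rightarrow> nat) UNIV {..<CARD('n)}"
proof -
  have "\<exists>e. bij_betw e (UNIV :: 'n set) {..<CARD('n)}"
    using ex_bij_betw_finite_nat[of "UNIV :: 'n set"] by (simp add: atLeast0LessThan)
  then show ?thesis unfolding idx_def by (rule someI_ex)
qed

lemma idx_less: "idx (i :: 'n::finite) < CARD('n)"
  using bij_idx bij_betwE by blast

lemma inv_idx: "inv idx (idx (i :: 'n::finite)) = i"
  by (rule inv_f_f) (use bij_idx in \<open>auto simp: bij_betw_def\<close>)

text \<open>The offset \<open>k\<close> lets several vectors be stored side by side in one sequence.\<close>

definition vec_of :: "nat \<Rightarrow> env \<Rightarrow> real^'n" where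
  "vec_of k x = (\<chi> i. x (k + idx i))"

definition env_of :: "nat \<Rightarrow> real^'n \<Rightarrow> env" where
  "env_of k v = (\<lambda>j. v $ inv idx (j - k))"

lemma vec_of_env_of: "vec_of k (env_of k v) = v"
  by (simp add: vec_of_def env_of_def inv_idx)

lemma vec_of_cong:
  assumes "\<And>i. k \<le> i \<Longrightarrow> i < k + CARD('n) \<Longrightarrow> x i = y i"
  shows "vec_of k x = (vec_of k y :: real^'n)"
  unfolding vec_of_def using assms idx_less[where 'n = 'n] by (simp add: vec_eq_iff)

lemma env_of_vec_of: "i < CARD('n) \<Longrightarrow> env_of 0 (vec_of 0 x :: real^'n) i = x i"
proof -
  assume "i < CARD('n)"
  then obtain j :: 'n where "i = idx j" using bij_idx unfolding bij_betw_def by (metis imageE lessThan_iff)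
  then show ?thesis by (simp add: env_of_def vec_of_def inv_idx)
qed

lemma continuous_on_vec_of: "continuous_on A (vec_of k :: env \<Rightarrow> real^'n)"
  unfolding vec_of_def
  by (intro continuous_on_vec_lambda continuous_on_subset[OF continuous_on_product_coordinates]) auto

lemma pol_vec_of:
  fixes p :: "real^'n \<Rightarrow> real"
  assumes "real_polynomial_function p" "k + CARD('n) \<le> m"
  shows "(\<lambda>x. p (vec_of k x)) \<in> pol m"
  using assms(1)
proof induction
  case (linear f)
  then interpret bounded_linear f .
  have f: "f v = (\<Sum>i\<in>UNIV. v $ i * f (axis i 1))" for v
  proof -
    have "v = (\<Sum>i\<in>UNIV. v $ i *\<^sub>R axis i 1)"
      using basis_expansion[of v] by (simp add: scalar_mult_eq_scaleR)
    then have "f v = f (\<Sum>i\<in>UNIV. v $ i *\<^sub>R axis i 1)" by simp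
    then show ?thesis by (simp add: sum scaleR)
  qed
  have "k + idx (i :: 'n) < m" for i using idx_less[of i] assms(2) by linarith
  then have "(\<lambda>x. \<Sum>i\<in>UNIV. (vec_of k x :: real^'n) $ i * f (axis i 1)) \<in> pol m"
    by (intro pol_sum pol.mult pol.const) (auto simp: vec_of_def intro: pol.var)
  moreover have "(\<lambda>x. f (vec_of k x)) = (\<lambda>x. \<Sum>i\<in>UNIV. (vec_of k x :: real^'n) $ i * f (axis i 1))"
    by (rule ext) (rule f)
  ultimately show ?case by (simp only:)
qed (auto intro: pol.intros)

lemma real_polynomial_env_of:
  "p \<in> pol m \<Longrightarrow> real_polynomial_function (\<lambda>v :: real^'n. p (env_of k v))"
proof (induction rule: pol.induct)
  case (var i)
  show ?case unfolding env_of_def by (intro real_polynomial_function.intros(1) bounded_linear_vec_nth)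
qed (auto intro: real_polynomial_function.intros)

lemma semialgebraic_imp_sa:
  fixes S :: "(real^'n) set"
  assumes "semialgebraic S" "k + CARD('n) \<le> m"
  shows "sa m {x. vec_of k x \<in> S}"
proof -
  obtain \<F> where F: "finite \<F>" "\<forall>B\<in>\<F>. basic_semialgebraic B" "S = \<Union>\<F>"
    using assms(1) unfolding semialgebraic_def by blast
  have basic: "sa m {x. vec_of k x \<in> B}" if B: "B \<in> \<F>" for B
  proof -
    from F(2) B have "basic_semialgebraic B" by blast
    then obtain H G where HG: "finite H" "finite G" "\<forall>h\<in>H. real_polynomial_function h"
        "\<forall>g\<in>G. real_polynomial_function g" "B = {x. (\<forall>h\<in>H. h x = 0) \<and> (\<forall>g\<in>G. g x < 0)}"
      unfolding basic_semialgebraic_def by (elim exE conjE) (rule that)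
    have "{x. vec_of k x \<in> B} = (\<Inter>h\<in>H. {x. h (vec_of k x) = 0}) \<inter> (\<Inter>g\<in>G. {x. g (vec_of k x) < 0})"
      unfolding HG(5) by auto
    also have "sa m \<dots>"
      using HG assms(2) by (intro sa_Int sa_INT sa_zero sa_neg pol_vec_of) auto
    finally show ?thesis .
  qed
  have "{x. vec_of k x \<in> S} = \<Union>((\<lambda>B. {x. vec_of k x \<in> B}) ` \<F>)" unfolding F(3) by auto
  then show ?thesis using F(1) basic by (auto intro!: sa_Union)
qed

lemma sa_imp_semialgebraic:
  assumes "sa m T"
  shows "semialgebraic {v :: real^'n. env_of k v \<in> T}"
proof -
  obtain H where H: "finite H" "H \<subseteq> pol m" "\<forall>x y. same_signs H x y \<longrightarrow> (x \<in> T \<longleftrightarrow> y \<in> T)"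
    using assms unfolding sa_def by blast
  let ?e = "env_of k :: real^'n \<Rightarrow> env"
  define cls where "cls v = {w. same_signs H (?e v) (?e w)}" for v
  have e: "cls ` (?e -` T) = (\<lambda>C. ?e -` C) ` (\<lambda>x. {y\<in>UNIV. same_signs H x y}) ` ?e ` (?e -` T)"
    by (simp add: image_image cls_def vimage_def)
  have "finite (cls ` (?e -` T))" unfolding e by (intro finite_imageI finite_sign_classes H(1))
  moreover have "basic_semialgebraic (cls v)" for v
    unfolding basic_semialgebraic_def
  proof (intro exI conjI)
    let ?Z = "(\<lambda>h w. h (?e w)) ` {h\<in>H. h (?e v) = 0}"
    let ?N = "(\<lambda>h w. h (?e w)) ` {h\<in>H. h (?e v) < 0} \<union> (\<lambda>h w. - h (?e w)) ` {h\<in>H. h (?e v) > 0}"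
    show "finite ?Z" "finite ?N" using H(1) by auto
    show "\<forall>h\<in>?Z. real_polynomial_function h"
      using H(2) by (auto intro!: real_polynomial_env_of)
    show "\<forall>g\<in>?N. real_polynomial_function g"
      using H(2) by (auto intro!: real_polynomial_env_of real_polynomial_function_minus)
    show "cls v = {w. (\<forall>h\<in>?Z. h w = 0) \<and> (\<forall>g\<in>?N. g w < 0)}"
    proof (rule set_eqI)
      fix w
      have s: "sgn (h (?e v)) = sgn (h (?e w)) \<longleftrightarrow> (h (?e v) = 0 \<longrightarrow> h (?e w) = 0) \<and>
          (h (?e v) < 0 \<longrightarrow> h (?e w) < 0) \<and> (h (?e v) > 0 \<longrightarrow> h (?e w) > 0)" for h :: "env \<Rightarrow> real"
        by (auto simp: sgn_if)
      have n: "(\<forall>g\<in>?N. g w < 0) \<longleftrightarrow> (\<forall>h\<in>H. (h (?e v) < 0 \<longrightarrow> h (?e w) < 0) \<and> (h (?e v) > 0 \<longrightarrow> h (?e w) > 0))"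
        unfolding ball_Un ball_simps by auto
      have z: "(\<forall>h\<in>?Z. h w = 0) \<longleftrightarrow> (\<forall>h\<in>H. h (?e v) = 0 \<longrightarrow> h (?e w) = 0)" by auto
      show "w \<in> cls v \<longleftrightarrow> w \<in> {w. (\<forall>h\<in>?Z. h w = 0) \<and> (\<forall>g\<in>?N. g w < 0)}"
        unfolding cls_def same_signs_def mem_Collect_eq s n z by (simp only: ball_conj_distrib)
    qed
  qed
  moreover have "{v. ?e v \<in> T} = \<Union>(cls ` (?e -` T))"
    using H(3) by (auto simp: cls_def same_signs_refl)
  ultimately show ?thesis unfolding semialgebraic_def by blast
qed

lemma semialgebraic_iff_sa:
  fixes S :: "(real^'n) set"
  assumes "k + CARD('n) \<le> m"
  shows "semialgebraic S \<longleftrightarrow> sa m {x. vec_of k x \<in> S}"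
proof
  assume "sa m {x. vec_of k x \<in> S}"
  from sa_imp_semialgebraic[OF this, where 'n = 'n and k = k] show "semialgebraic S" by (simp add: vec_of_env_of)
qed (rule semialgebraic_imp_sa[OF _ assms])

lemma semialgebraic_Union:
  fixes \<C> :: "(real^'n) set set"
  assumes "finite \<C>" "\<And>C. C \<in> \<C> \<Longrightarrow> semialgebraic C"
  shows "semialgebraic (\<Union>\<C>)"
proof -
  have "{x. vec_of 0 x \<in> \<Union>\<C>} = \<Union>((\<lambda>C. {x. vec_of 0 x \<in> C}) ` \<C>)" by auto
  then show ?thesis
    using assms semialgebraic_imp_sa[of _ 0 "CARD('n)"]
    by (auto simp: semialgebraic_iff_sa[of 0 "CARD('n)"] intro!: sa_Union)
qed

text \<open>The cylinder over \<open>S\<close> is cut into pieces, which are then projected; as cylinders they have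
  semialgebraic projections.\<close>

lemma semialgebraic_path_connected_pieces:
  fixes S :: "(real^'n) set"
  assumes "semialgebraic S"
  shows "\<exists>\<C>. finite \<C> \<and> (\<forall>C\<in>\<C>. semialgebraic C \<and> path_connected C) \<and> S = \<Union>\<C>"
proof -
  obtain \<C> where C: "finite \<C>" "\<forall>C\<in>\<C>. sa CARD('n) C \<and> path_connected C" "{x. vec_of 0 x \<in> S} = \<Union>\<C>"
    using sa_path_connected_pieces[OF semialgebraic_imp_sa[OF assms, of 0 "CARD('n)"]] by auto
  let ?v = "vec_of 0 :: env \<Rightarrow> real^'n"
  have "semialgebraic (?v ` C) \<and> path_connected (?v ` C)" if "C \<in> \<C>" for C
  proof
    have sC: "sa CARD('n) C" using C(2) that by blast
    have inC: "env_of 0 (?v x) \<in> C \<longleftrightarrow> x \<in> C" for x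
      by (rule sa_cong[OF sC]) (rule env_of_vec_of)
    have "?v ` C = {v. env_of 0 v \<in> C}"
    proof
      show "?v ` C \<subseteq> {v. env_of 0 v \<in> C}" using inC by blast
      show "{v. env_of 0 v \<in> C} \<subseteq> ?v ` C"
      proof
        fix v :: "real^'n" assume "v \<in> {v. env_of 0 v \<in> C}"
        moreover have "v = ?v (env_of 0 v)" by (simp add: vec_of_env_of)
        ultimately show "v \<in> ?v ` C" by blast
      qed
    qed
    then show "semialgebraic (?v ` C)" using sa_imp_semialgebraic[OF sC] by simp
    show "path_connected (?v ` C)"
      using C(2) that by (intro path_connected_continuous_image continuous_on_vec_of) blast
  qed
  moreover have "S = \<Union>((`) ?v ` \<C>)"
  proof -
    have "S \<subseteq> ?v ` {x. ?v x \<in> S}"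
    proof
      fix v assume "v \<in> S"
      then show "v \<in> ?v ` {x. ?v x \<in> S}" by (intro image_eqI[of _ _ "env_of 0 v"]) (simp_all add: vec_of_env_of)
    qed
    then have "S = ?v ` {x. ?v x \<in> S}" by blast
    then show ?thesis unfolding C(3) by blast
  qed
  ultimately show ?thesis using C(1) by (intro exI[of _ "(`) ?v ` \<C>"]) auto
qed

text \<open>The set of all \<open>(t, v)\<close> with \<open>v \<in> V\<close> at distance less than \<open>t\<close> from \<open>a\<close> has points over every
  \<open>t > 0\<close>; a curve in it, parametrised by \<open>t\<close>, tends to \<open>a\<close>.\<close>

lemma curve_selection:
  fixes V :: "(real^'n) set"
  assumes "semialgebraic V" "a \<in> closure V"
  shows "\<exists>b\<in>V. path_component (insert a V) a b"
proof -
  let ?v = "vec_of 1 :: env \<Rightarrow> real^'n" and ?m = "Suc CARD('n)"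
  define q :: "env \<Rightarrow> real" where "q = (\<lambda>x. (\<Sum>i\<in>UNIV. (x (1 + idx (i::'n)) - a $ i)\<^sup>2) - (x 0)\<^sup>2)"
  have "q \<in> pol ?m" unfolding q_def
    by (intro pol_diff pol_sum pol_power pol.var pol.const) (auto simp: idx_less)
  have q: "q x < 0 \<longleftrightarrow> norm (?v x - a) < x 0" if "x 0 > 0" for x
  proof -
    have "(\<Sum>i\<in>UNIV. (x (1 + idx (i::'n)) - a $ i)\<^sup>2) = (norm (?v x - a))\<^sup>2"
      unfolding power2_norm_eq_inner inner_vec_def by (simp add: vec_of_def power2_eq_square)
    then have "q x < 0 \<longleftrightarrow> (norm (?v x - a))\<^sup>2 < (x 0)\<^sup>2" unfolding q_def by simp
    also have "\<dots> \<longleftrightarrow> norm (?v x - a) < x 0"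
      using that by (simp add: power2_less_imp_less power_strict_mono order_less_imp_le
        abs_le_square_iff[symmetric] not_le[symmetric] del: not_le)
    finally show ?thesis .
  qed
  let ?T = "{x. ?v x \<in> V} \<inter> {x. q x < 0}"
  have T: "sa ?m ?T"
    using semialgebraic_imp_sa[OF assms(1), of 1 ?m] \<open>q \<in> pol ?m\<close> by (intro sa_Int sa_neg) auto
  have ex: "\<exists>x\<in>?T. x 0 = t" if t: "t > 0" for t
  proof -
    obtain v where v: "v \<in> V" "dist v a < t" using assms(2) t by (auto simp: closure_approachable)
    define x where "x = (env_of 1 v)(0 := t)"
    have "?v x = ?v (env_of 1 v)" by (rule vec_of_cong) (simp add: x_def)
    then have "?v x = v" by (simp add: vec_of_env_of)
    moreover have "x 0 = t" by (simp add: x_def)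
    ultimately show ?thesis using v q[of x] t by (auto simp: dist_norm)
  qed
  have "\<forall>\<^sub>F t::real in at_right 0. t \<in> {0<..<1}" by (rule eventually_at_right_real) simp
  then have "\<forall>\<^sub>F t in at_right 0. \<exists>x\<in>?T. x 0 = t" by (rule eventually_mono) (use ex in auto)
  then have "\<exists>\<^sub>F t in at_right 0. \<exists>x\<in>?T. x 0 = t"
    by (rule eventually_frequently[rotated]) simp
  from sa_curve[OF T this] obtain \<epsilon> \<gamma> where g: "\<epsilon> > 0" "continuous_on {0<..<\<epsilon>} \<gamma>"
    "\<And>t. t \<in> {0<..<\<epsilon>} \<Longrightarrow> \<gamma> t \<in> ?T \<and> \<gamma> t 0 = t" by blast
  define c where "c t = (if t = 0 then a else ?v (\<gamma> t))" for t
  define r where "r = \<epsilon> / 2"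
  have r: "0 < r" "r < \<epsilon>" using g(1) by (auto simp: r_def)
  have cV: "c t \<in> V" "norm (c t - a) < t" if "0 < t" "t \<le> r" for t
    using g(3)[of t] q[of "\<gamma> t"] that r by (auto simp: c_def)
  have "continuous_on {0..r} c"
    unfolding continuous_on_eq_continuous_within
  proof
    fix t assume t: "t \<in> {0..r}"
    show "continuous (at t within {0..r}) c"
    proof (cases "t = 0")
      case True
      have "dist (c s) (c 0) \<le> s" if "s \<in> {0..r}" for s
        using cV(2)[of s] that by (cases "s = 0") (auto simp: c_def dist_norm)
      then show ?thesis unfolding True continuous_within_eps_delta
        by (intro allI impI) (metis dist_0_norm dist_commute atLeastAtMost_iff abs_of_nonneg le_less_trans real_norm_def)
    next
      case False
      have "continuous_on {0<..r} (\<lambda>s. ?v (\<gamma> s))"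
        using r by (intro continuous_on_compose2[OF continuous_on_vec_of[of UNIV]]
            continuous_on_subset[OF g(2)]) auto
      then have "continuous_on {0<..r} c" by (rule continuous_on_eq) (auto simp: c_def)
      then have "continuous (at t within {0<..r}) c"
        using False t by (auto simp: continuous_on_eq_continuous_within)
      moreover have "at t within {0..r} = at t within {0<..r}"
        using False t by (intro at_within_nhd[of t "{0<..}"]) auto
      ultimately show ?thesis by simp
    qed
  qed
  then have "path_connected (c ` {0..r})"
    by (intro path_connected_continuous_image convex_imp_path_connected convex_real_interval)
  moreover have "c ` {0..r} \<subseteq> insert a V"
  proof (rule image_subsetI)
    fix t assume "t \<in> {0..r}"
    then show "c t \<in> insert a V" using cV(1)[of t] by (cases "t = 0") (auto simp: c_def)
  qed
  moreover have "a \<in> c ` {0..r}" using r by (auto simp: c_def intro!: image_eqI[of _ _ 0])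
  moreover have "c r \<in> c ` {0..r}" using r by simp
  ultimately have "path_component (insert a V) a (c r)"
    by (meson path_component_of_subset path_connected_component)
  moreover have "c r \<in> V" using cV(1) r by simp
  ultimately show ?thesis by blast
qed

section \<open>Connected components\<close>

text \<open>Each path component is a union of path-connected semialgebraic pieces, so there are finitely
  many of them and they are semialgebraic. By curve selection a point of \<open>S\<close> in the closure of a
  path component belongs to it. Being closed, disjoint and finite in number, the path components
  cannot be merged by a connected set.\<close>

theorem semialgebraic_components:
  fixes S :: "(real^'n) set"
  assumes "semialgebraic S"
  shows "finite (components S) \<and> (\<forall>C\<in>components S. path_connected C)"
proof -
  let ?P = "path_component_set S"
  obtain \<C> where C: "finite \<C>" "\<And>C. C \<in> \<C> \<Longrightarrow> semialgebraic C" "\<And>C. C \<in> \<C> \<Longrightarrow> path_connected C" "S = \<Union>\<C>"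
    using semialgebraic_path_connected_pieces[OF assms] by blast
  have P_eq: "?P x = \<Union>{C\<in>\<C>. C \<subseteq> ?P x}" for x
  proof
    show "?P x \<subseteq> \<Union>{C\<in>\<C>. C \<subseteq> ?P x}"
    proof
      fix y assume y: "y \<in> ?P x"
      then have "y \<in> S" using path_component_subset by blast
      then obtain D where D: "D \<in> \<C>" "y \<in> D" using C(4) by blast
      have "D \<subseteq> ?P y" using D C(4) by (intro path_component_maximal C(3)) auto
      moreover have "?P y = ?P x" using y path_component_eq by blast
      ultimately show "y \<in> \<Union>{C\<in>\<C>. C \<subseteq> ?P x}" using D by blast
    qed
  qed blast
  have "?P ` S \<subseteq> Union ` Pow \<C>" using P_eq by blast
  then have fin: "finite (?P ` S)" by (rule finite_subset) (simp add: C(1))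
  have "semialgebraic (\<Union>{C\<in>\<C>. C \<subseteq> ?P x})" for x using C(1,2) by (intro semialgebraic_Union) auto
  then have sP: "semialgebraic (?P x)" for x by (subst P_eq)
  have closed: "S \<inter> closure (?P x) = ?P x" for x
  proof
    show "S \<inter> closure (?P x) \<subseteq> ?P x"
    proof
      fix a assume a: "a \<in> S \<inter> closure (?P x)"
      then obtain b where b: "b \<in> ?P x" "path_component (insert a (?P x)) a b"
        using curve_selection[OF sP] by blast
      have "insert a (?P x) \<subseteq> S" using a path_component_subset by blast
      then have "path_component S a b" using b(2) path_component_of_subset by blast
      then show "a \<in> ?P x" using b(1) by (auto intro: path_component_trans path_component_sym)
    qed
    show "?P x \<subseteq> S \<inter> closure (?P x)" using path_component_subset closure_subset by blast
  qed
  have conn: "connected_component_set S x = ?P x" if x: "x \<in> S" for x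
  proof
    let ?K = "connected_component_set S x"
    let ?Q = "\<Union>{closure D |D. D \<in> ?P ` S \<and> D \<noteq> ?P x}"
    have Q: "closed ?Q"
    proof (rule closed_Union)
      have "{closure D |D. D \<in> ?P ` S \<and> D \<noteq> ?P x} \<subseteq> closure ` ?P ` S" by blast
      then show "finite {closure D |D. D \<in> ?P ` S \<and> D \<noteq> ?P x}"
        by (rule finite_subset) (intro finite_imageI fin)
    qed auto
    have disj: "D = ?P x" if "D \<in> ?P ` S" "D \<inter> ?P x \<noteq> {}" for D
      using that path_component_eq by blast
    have K: "?K \<subseteq> S" "connected ?K" "x \<in> ?K" by (auto simp: connected_component_subset x)
    have cover: "?K \<subseteq> closure (?P x) \<union> ?Q"
    proof
      fix y assume "y \<in> ?K"
      then have "y \<in> S" using K(1) by blast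
      then have y: "y \<in> ?P y" by (simp add: path_component_refl)
      show "y \<in> closure (?P x) \<union> ?Q"
      proof (cases "?P y = ?P x")
        case True
        then have "y \<in> ?P x" using y by (simp only:)
        then show ?thesis using closure_subset[of "?P x"] by blast
      next
        case False
        then have "closure (?P y) \<subseteq> ?Q" using \<open>y \<in> S\<close> by (intro Union_upper) auto
        moreover have "y \<in> closure (?P y)" using y closure_subset[of "?P y"] by (rule subsetD[rotated])
        ultimately show ?thesis by (intro UnI2) (rule subsetD)
      qed
    qed
    have "closure (?P x) \<inter> ?Q \<inter> ?K = {}"
    proof (rule ccontr)
      assume "closure (?P x) \<inter> ?Q \<inter> ?K \<noteq> {}"
      then obtain y D where y: "y \<in> closure (?P x)" "y \<in> closure D" "D \<in> ?P ` S" "D \<noteq> ?P x" "y \<in> ?K" by blast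
      have "y \<in> S" using y(5) K(1) by (rule subsetD[rotated])
      then have "y \<in> ?P x" using closed[of x] y(1) by (metis IntI)
      obtain w where w: "D = ?P w" using y(3) by (rule imageE)
      then have "y \<in> D" using closed[of w] y(2) \<open>y \<in> S\<close> by (metis IntI)
      then have "D = ?P x" using \<open>y \<in> ?P x\<close> by (intro disj y(3)) (metis IntI emptyE)
      then show False using y(4) by (rule notE[rotated])
    qed
    from connected_closedD[OF K(2) this cover closed_closure Q]
    have "closure (?P x) \<inter> ?K = {} \<or> ?Q \<inter> ?K = {}" .
    moreover have "x \<in> ?P x" using x by (simp add: path_component_refl)
    then have "x \<in> closure (?P x)" using closure_subset by (rule subsetD[rotated])
    ultimately have "?Q \<inter> ?K = {}" using K(3) by (metis IntI emptyE)
    moreover have "Y \<subseteq> A" if "Y \<subseteq> A \<union> B" "B \<inter> Y = {}" for Y A B :: "(real^'n) set"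
      using that by blast
    ultimately have "?K \<subseteq> closure (?P x)" using cover by (simp only:)
    then have "?K \<subseteq> S \<inter> closure (?P x)" using K(1) by (intro Int_greatest)
    then show "?K \<subseteq> ?P x" by (simp only: closed)
    show "?P x \<subseteq> ?K" by (rule path_component_subset_connected_component)
  qed
  have "components S = ?P ` S" unfolding components_def using conn by auto
  then show ?thesis using fin path_connected_path_component by auto
qed

section \<open>Stationary points\<close>

lemma gradient_polynomial:
  assumes "real_polynomial_function f"
  shows "real_polynomial_function (\<lambda>x :: real^'n. gradient f x $ i)"
  using assms
proof induction
  case (linear f)
  then interpret bounded_linear f .
  have "f h = inner h (adjoint f 1)" for h
    using adjoint_works[OF linear_axioms, of h 1] by simp
  then have "f = (\<lambda>h. inner h (adjoint f 1))" by blast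
  then have "gradient f x = adjoint f 1" for x
    using bounded_linear_imp_has_derivative[OF bounded_linear_axioms]
    by (intro gradient_eqI) (metis gderiv_def)
  then show ?case by (simp add: real_polynomial_function.intros(2))
next
  case (const c)
  have "gradient (\<lambda>x. c) x = 0" for x :: "real^'n" by (intro gradient_eqI GDERIV_const)
  then show ?case by (simp add: real_polynomial_function.intros(2))
next
  case (add f g)
  have "gradient (\<lambda>x. f x + g x) x = gradient f x + gradient g x" for x
    using add.hyps by (intro gradient_eqI GDERIV_add GDERIV_gradient_polynomial)
  then show ?case using add.IH by (simp add: real_polynomial_function.intros(3))
next
  case (mult f g)
  have "gradient (\<lambda>x. f x * g x) x = f x *\<^sub>R gradient g x + g x *\<^sub>R gradient f x" for x
    using mult.hyps by (intro gradient_eqI GDERIV_mult GDERIV_gradient_polynomial)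
  then show ?case using mult by (auto intro!: real_polynomial_function.intros(3) real_polynomial_function.intros(4))
qed

lemma sa_project_above:
  "sa (n + k) S \<Longrightarrow> sa n {x. \<exists>z\<in>S. \<forall>i<n. z i = x i}"
proof (induction k arbitrary: S)
  case 0
  have "(\<exists>z\<in>S. \<forall>i<n. z i = x i) \<longleftrightarrow> x \<in> S" for x
  proof
    assume "\<exists>z\<in>S. \<forall>i<n. z i = x i"
    then obtain z where "z \<in> S" "\<And>i. i < n \<Longrightarrow> z i = x i" by blast
    then show "x \<in> S" using sa_cong[of n S z x] 0 by simp
  qed blast
  then show ?case using 0 by simp
next
  case (Suc k)
  let ?S = "{x. \<exists>t. x(n + k := t) \<in> S}"
  have "sa n {x. \<exists>z\<in>?S. \<forall>i<n. z i = x i}"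
    using Suc by (intro Suc.IH sa_projection) simp
  moreover have "(\<exists>z\<in>?S. \<forall>i<n. z i = x i) \<longleftrightarrow> (\<exists>z\<in>S. \<forall>i<n. z i = x i)" for x
  proof
    assume "\<exists>z\<in>?S. \<forall>i<n. z i = x i"
    then obtain z t where "z(n + k := t) \<in> S" "\<forall>i<n. z i = x i" by blast
    then show "\<exists>z\<in>S. \<forall>i<n. z i = x i" by (intro bexI[of _ "z(n + k := t)"]) auto
  next
    assume "\<exists>z\<in>S. \<forall>i<n. z i = x i"
    then obtain z where z: "z \<in> S" "\<forall>i<n. z i = x i" by blast
    then have "z(n + k := z (n + k)) \<in> S" by simp
    then show "\<exists>z\<in>?S. \<forall>i<n. z i = x i" using z by blast
  qed
  ultimately show ?case by simp
qed

text \<open>The points \<open>x\<close>, the weights \<open>\<xi>\<close> and the test points \<open>y\<close> occupy consecutive blocks of variables,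
  in the order in which the quantifiers over \<open>y\<close> and \<open>\<xi>\<close> have to be eliminated.\<close>

lemma semialgebraic_UN_Sol_VI:
  fixes K :: "(real^'n) set" and f :: "'m::finite \<Rightarrow> real^'n \<Rightarrow> real" and \<Delta> :: "(real^'m) set"
  assumes K: "semialgebraic K" and \<Delta>: "semialgebraic \<Delta>"
    and f: "\<And>l. real_polynomial_function (f l)"
  shows "semialgebraic (\<Union>\<xi>\<in>\<Delta>. Sol_VI K f \<xi>)"
proof -
  let ?n = "CARD('n)" and ?m = "CARD('m)"
  let ?x = "vec_of 0 :: env \<Rightarrow> real^'n" and ?w = "vec_of ?n :: env \<Rightarrow> real^'m"
    and ?y = "vec_of (?n + ?m) :: env \<Rightarrow> real^'n"
  define g where "g \<xi> x y = inner (\<Sum>l\<in>UNIV. \<xi> $ l *\<^sub>R gradient (f l) x) (y - x)" for \<xi> :: "real^'m" and x y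
  have g_sum: "g \<xi> x y = (\<Sum>l\<in>UNIV. \<xi> $ l * (\<Sum>i\<in>UNIV. gradient (f l) x $ i * (y $ i - x $ i)))" for \<xi> x y
    unfolding g_def inner_sum_left inner_scaleR_left by (simp add: inner_vec_def)
  have coord: "(\<lambda>e. (vec_of k e :: real^'k) $ i) \<in> pol j" if "k + CARD('k) \<le> j" for k i j
  proof -
    have "k + idx i < j" using idx_less[of i] that by linarith
    then show ?thesis by (simp add: vec_of_def pol.var)
  qed
  have g_pol: "(\<lambda>e. g (?w e) (?x e) (?y e)) \<in> pol (?n + ?m + ?n)"
    unfolding g_sum
    by (intro pol_sum pol.mult pol_diff coord pol_vec_of[OF gradient_polynomial[OF f]]) simp_all
  \<comment> \<open>The test points that violate the variational inequality.\<close>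
  define A where "A = {e. ?y e \<in> K} \<inter> {e. g (?w e) (?x e) (?y e) < 0}"
  have "sa (?n + ?m + ?n) A"
    unfolding A_def using g_pol by (intro sa_Int sa_neg semialgebraic_imp_sa[OF K]) simp_all
  then have B: "sa (?n + ?m) {e. \<exists>z\<in>A. \<forall>i<?n + ?m. z i = e i}" by (rule sa_project_above)
  define D where "D = {e. ?x e \<in> K} \<inter> {e. ?w e \<in> \<Delta>} \<inter> - {e. \<exists>z\<in>A. \<forall>i<?n + ?m. z i = e i}"
  have "sa (?n + ?m) D"
    unfolding D_def using B by (intro sa_Int sa_Compl semialgebraic_imp_sa[OF K] semialgebraic_imp_sa[OF \<Delta>]) simp_all
  then have "sa ?n {e. \<exists>z\<in>D. \<forall>i<?n. z i = e i}" by (rule sa_project_above)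
  then have S: "semialgebraic {v :: real^'n. env_of 0 v \<in> {e. \<exists>z\<in>D. \<forall>i<?n. z i = e i}}"
    by (rule sa_imp_semialgebraic)
  have D_iff: "e \<in> D \<longleftrightarrow> ?w e \<in> \<Delta> \<and> ?x e \<in> Sol_VI K f (?w e)" for e
  proof -
    have "(\<exists>z\<in>A. \<forall>i<?n + ?m. z i = e i) \<longleftrightarrow> (\<exists>y\<in>K. g (?w e) (?x e) y < 0)"
    proof
      assume "\<exists>z\<in>A. \<forall>i<?n + ?m. z i = e i"
      then obtain z where z: "z \<in> A" "\<And>i. i < ?n + ?m \<Longrightarrow> z i = e i" by blast
      have "?x z = ?x e" "?w z = ?w e" by (rule vec_of_cong; use z(2) in simp)+
      then show "\<exists>y\<in>K. g (?w e) (?x e) y < 0" using z(1) unfolding A_def by auto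
    next
      assume "\<exists>y\<in>K. g (?w e) (?x e) y < 0"
      then obtain y where y: "y \<in> K" "g (?w e) (?x e) y < 0" by blast
      define z where "z = (\<lambda>i. if i < ?n + ?m then e i else env_of (?n + ?m) y i)"
      have "?x z = ?x e" "?w z = ?w e" by (rule vec_of_cong; simp add: z_def)+
      moreover have "?y z = ?y (env_of (?n + ?m) y)" by (rule vec_of_cong) (simp add: z_def)
      ultimately have "z \<in> A" using y by (simp add: A_def vec_of_env_of)
      then show "\<exists>z\<in>A. \<forall>i<?n + ?m. z i = e i" by (intro bexI[of _ z]) (simp add: z_def)
    qed
    then show ?thesis unfolding D_def Sol_VI_def g_def[symmetric] by (auto simp: not_less)
  qed
  have "{v :: real^'n. env_of 0 v \<in> {e. \<exists>z\<in>D. \<forall>i<?n. z i = e i}} = (\<Union>\<xi>\<in>\<Delta>. Sol_VI K f \<xi>)"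
  proof (intro set_eqI iffI)
    fix v assume "v \<in> {v :: real^'n. env_of 0 v \<in> {e. \<exists>z\<in>D. \<forall>i<?n. z i = e i}}"
    then obtain z where z: "z \<in> D" "\<And>i. i < ?n \<Longrightarrow> z i = env_of 0 v i" by blast
    have "?x z = ?x (env_of 0 v)" by (rule vec_of_cong) (use z(2) in simp)
    then have "?x z = v" by (simp add: vec_of_env_of)
    then show "v \<in> (\<Union>\<xi>\<in>\<Delta>. Sol_VI K f \<xi>)" using z(1) D_iff by blast
  next
    fix v assume "v \<in> (\<Union>\<xi>\<in>\<Delta>. Sol_VI K f \<xi>)"
    then obtain \<xi> where \<xi>: "\<xi> \<in> \<Delta>" "v \<in> Sol_VI K f \<xi>" by blast
    define z where "z = (\<lambda>i. if i < ?n then env_of 0 v i else env_of ?n \<xi> i)"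
    have "?x z = ?x (env_of 0 v)" "?w z = ?w (env_of ?n \<xi>)" by (rule vec_of_cong; simp add: z_def)+
    then have "z \<in> D" using \<xi> by (simp add: D_iff vec_of_env_of)
    moreover have "\<forall>i<?n. z i = env_of 0 v i" by (simp add: z_def)
    ultimately show "v \<in> {v :: real^'n. env_of 0 v \<in> {e. \<exists>z\<in>D. \<forall>i<?n. z i = e i}}" by blast
  qed
  then show ?thesis using S by simp
qed

lemma sa_simplex_conditions:
  "sa CARD('m) {x. (\<forall>l. (vec_of 0 x :: real^'m::finite) $ l \<ge> 0) \<and> (\<Sum>l\<in>UNIV. (vec_of 0 x :: real^'m) $ l) = 1}" (is ?Q)
  "sa CARD('m) {x. \<forall>l. (vec_of 0 x :: real^'m) $ l > 0}" (is ?R)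
proof -
  have c: "(\<lambda>x. (vec_of 0 x :: real^'m) $ l) \<in> pol CARD('m)" for l
    by (simp add: vec_of_def pol.var idx_less)
  have "{x. (\<forall>l. (vec_of 0 x :: real^'m) $ l \<ge> 0) \<and> (\<Sum>l\<in>UNIV. (vec_of 0 x :: real^'m) $ l) = 1} =
     (\<Inter>l\<in>UNIV. {x. (vec_of 0 x :: real^'m) $ l \<ge> 0}) \<inter> {x. (\<Sum>l\<in>UNIV. (vec_of 0 x :: real^'m) $ l) - 1 = 0}"
    by auto
  also have "sa CARD('m) \<dots>"
    by (intro sa_Int sa_INT sa_nonneg sa_zero pol_diff pol_sum c pol.const finite)
  finally show ?Q .
  have "{x. \<forall>l. (vec_of 0 x :: real^'m) $ l > 0} = (\<Inter>l\<in>UNIV. {x. (vec_of 0 x :: real^'m) $ l > 0})" by auto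
  also have "sa CARD('m) \<dots>" by (intro sa_INT sa_pos c finite)
  finally show ?R .
qed

lemma semialgebraic_std_simplex: "semialgebraic (std_simplex :: (real^'m::finite) set)"
  unfolding semialgebraic_iff_sa[of 0 "CARD('m)", OF order_eq_refl[OF add_0]] std_simplex_def mem_Collect_eq
  by (rule sa_simplex_conditions)

lemma semialgebraic_ri_std_simplex: "semialgebraic (ri_std_simplex :: (real^'m::finite) set)"
  unfolding semialgebraic_iff_sa[of 0 "CARD('m)", OF order_eq_refl[OF add_0]] ri_std_simplex_def std_simplex_def mem_Collect_eq
  using sa_Int[OF sa_simplex_conditions[where 'm = 'm]] by (simp add: Collect_conj_eq Int_assoc)

theorem proposition3p2:
  fixes K :: "(real^'n) set" and f :: "'m::finite \<Rightarrow> real^'n \<Rightarrow> real"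
  assumes "K \<noteq> {}" and "closed K" and "semialgebraic K"
    and "\<And>l. real_polynomial_function (f l)"
  shows "semialgebraic (Stat_PVP K f) \<and> semialgebraic (Pr_PVP K f) \<and>
    finite (components (Stat_PVP K f)) \<and>
    (\<forall>C\<in>components (Stat_PVP K f). path_connected C) \<and>
    finite (components (Pr_PVP K f)) \<and>
    (\<forall>C\<in>components (Pr_PVP K f). path_connected C)"
proof -
  have "semialgebraic (Stat_PVP K f)" "semialgebraic (Pr_PVP K f)"
    unfolding Stat_PVP_def Pr_PVP_def
    by (intro semialgebraic_UN_Sol_VI assms semialgebraic_std_simplex semialgebraic_ri_std_simplex)+
  then show ?thesis using semialgebraic_components by blast
qed

end
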